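(* For every simple trunc $G$ there is a Boolean pointed space $(X,* )$, unique up to isomorphism (homeomorphism preserving the designated point), such that $G$ is isomorphic, as a trunc, to the trunc of all locally constant functions $X\to\mathbb R$ which vanish at the designated point $*$.
   Context: All vector lattices are real. A truncation on an archimedean vector lattice $G$ is a unary operation $g\mapsto\overline g$ on $G^+$ such that for all $g,h\in G^+$: $g\wedge\overline h\le\overline g\le g$; if $\overline g=0$ then $g=0$; if $ng=\overline{ng}$ for all positive integers $n$ then $g=0$. A trunc is an archimedean vector lattice with a truncation; trunc isomorphisms are vector lattice isomorphisms preserving truncation. $\overline G=\{\overline g:g\in G^+\}$. For $f,g\in G^+$, $f$ is a component of $g$ if $f\le g$ and $f\wedge(g-f)=0$. A unital component of $G$ is an element $u\in\overline G$ such that $u\wedge g$ is a component of $g$ for every $g\in\overline G$. A trunc is simple if every element is a finite real linear combination of unital components. A Boolean pointed space is a zero-dimensional compact Hausdorff space $X$ with a designated point $*$. A function on $X$ is locally constant if every point has a neighborhood on which it is constant. The set of locally constant real functions vanishing at $*$ is a trunc under pointwise operations with truncation $\overline f(x)=\min(f(x),1)$. *)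

theory Defs
  imports "HOL-Analysis.Analysis" "HOL-Library.Lattice_Algebras"
begin

class vector_lattice = ordered_real_vector + lattice
begin

subclass lattice_ab_group_add ..

end

(* A truncation is an operation on the positive cone only: the total function tr is
   constrained, and used by every definition below, at nonnegative arguments alone. *)
locale trunc =
  fixes tr :: "'g::vector_lattice \<Rightarrow> 'g"
  assumes archimedean: "\<lbrakk>0 \<le> g; 0 \<le> h; \<And>n::nat. real n *\<^sub>R g \<le> h\<rbrakk> \<Longrightarrow> g = 0"
    and tr_nonneg: "0 \<le> g \<Longrightarrow> 0 \<le> tr g"
    and inf_tr_le: "\<lbrakk>0 \<le> g; 0 \<le> h\<rbrakk> \<Longrightarrow> inf g (tr h) \<le> tr g"
    and tr_le: "0 \<le> g \<Longrightarrow> tr g \<le> g"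
    and tr_eq_0: "\<lbrakk>0 \<le> g; tr g = 0\<rbrakk> \<Longrightarrow> g = 0"
    and tr_multiples: "\<lbrakk>0 \<le> g; \<And>n::nat. 0 < n \<Longrightarrow> tr (real n *\<^sub>R g) = real n *\<^sub>R g\<rbrakk> \<Longrightarrow> g = 0"

definition truncated :: "('g::vector_lattice \<Rightarrow> 'g) \<Rightarrow> 'g set"
  where "truncated tr = tr ` {g. 0 \<le> g}"

definition component_of :: "'g::vector_lattice \<Rightarrow> 'g \<Rightarrow> bool"
  where "component_of f g \<longleftrightarrow> 0 \<le> f \<and> 0 \<le> g \<and> f \<le> g \<and> inf f (g - f) = 0"

definition unital_component :: "('g::vector_lattice \<Rightarrow> 'g) \<Rightarrow> 'g \<Rightarrow> bool"
  where "unital_component tr u \<longleftrightarrow>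
    u \<in> truncated tr \<and> (\<forall>g \<in> truncated tr. component_of (inf u g) g)"

locale simple_trunc = trunc +
  assumes simple: "g \<in> span {u. unital_component tr u}"

definition boolean_pointed_space :: "'x topology \<Rightarrow> 'x \<Rightarrow> bool"
  where "boolean_pointed_space X p \<longleftrightarrow>
    compact_space X \<and> Hausdorff_space X \<and> X dim_le 0 \<and> p \<in> topspace X"

definition locally_constant_on :: "'x topology \<Rightarrow> ('x \<Rightarrow> 'a) \<Rightarrow> bool"
  where "locally_constant_on X f \<longleftrightarrow>
    (\<forall>x \<in> topspace X. \<exists>U. openin X U \<and> x \<in> U \<and> (\<forall>y \<in> U. f y = f x))"

(* A function on the space X is represented by its extension by 0 to the whole type,
   so that equality of functions on X is equality in HOL. *)
definition loc_const_functions :: "'x topology \<Rightarrow> 'x \<Rightarrow> ('x \<Rightarrow> real) set"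
  where "loc_const_functions X p =
    {f. locally_constant_on X f \<and> f p = 0 \<and> (\<forall>x. x \<notin> topspace X \<longrightarrow> f x = 0)}"

definition trunc_iso_loc_const ::
    "('g::vector_lattice \<Rightarrow> 'g) \<Rightarrow> 'x topology \<Rightarrow> 'x \<Rightarrow> ('g \<Rightarrow> 'x \<Rightarrow> real) \<Rightarrow> bool"
  where "trunc_iso_loc_const tr X p \<phi> \<longleftrightarrow>
    bij_betw \<phi> UNIV (loc_const_functions X p) \<and>
    (\<forall>g h. \<phi> (g + h) = (\<lambda>x. \<phi> g x + \<phi> h x)) \<and>
    (\<forall>c g. \<phi> (c *\<^sub>R g) = (\<lambda>x. c * \<phi> g x)) \<and>
    (\<forall>g h. \<phi> (inf g h) = (\<lambda>x. min (\<phi> g x) (\<phi> h x))) \<and>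
    (\<forall>g h. \<phi> (sup g h) = (\<lambda>x. max (\<phi> g x) (\<phi> h x))) \<and>
    (\<forall>g. 0 \<le> g \<longrightarrow> \<phi> (tr g) = (\<lambda>x. min (\<phi> g x) 1))"

definition represents :: "'x topology \<Rightarrow> 'x \<Rightarrow> ('g::vector_lattice \<Rightarrow> 'g) \<Rightarrow> bool"
  where "represents X p tr \<longleftrightarrow>
    boolean_pointed_space X p \<and> (\<exists>\<phi>. trunc_iso_loc_const tr X p \<phi>)"

definition pointed_homeomorphic :: "'x topology \<Rightarrow> 'x \<Rightarrow> 'y topology \<Rightarrow> 'y \<Rightarrow> bool"
  where "pointed_homeomorphic X p Y q \<longleftrightarrow> (\<exists>h. homeomorphic_map X Y h \<and> h p = q)"

end

(* A point of the representing space is a set F of unital components that is a prime filter of the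
   generalized Boolean algebra of unital components; the empty set is allowed and is the designated
   point. The value of g at a nonempty F is the unique c for which g - c v is disjoint from some v in F.
   It exists because the unital components span, and it respects the lattice operations because the
   disjoint complement of v is an ideal. If g has value 0 everywhere, then separating ideals from
   prime filters shows that g is disjoint from every unital component, hence from itself. Every
   locally constant function is attained because the clopen sets avoiding the designated point are
   exactly the sets of points containing a given unital component. For uniqueness, any representing
   space is homeomorphic to this one through x |-> {u. u takes the value 1 at x}. *)

theory Submission
  imports Defs
begin

text \<open>The obstacle is that \<open>G\<close> need not contain a constant function 1, so the
  value of \<open>g\<close> has nothing global to be measured against. Each unital component
  \<open>v\<close> serves as a local unit: at a filter containing \<open>v\<close>, the constant
  \<open>c\<close> is played by \<open>c *\<^sub>R v\<close>. The empty filter is the only point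
  without a local unit. Values respect \<open>sup\<close> and \<open>tr\<close> because both
  operations are nonexpansive, so congruence modulo the elements disjoint from \<open>v\<close>
  survives them. Uniqueness rests on the fact that in any representation the unital components are
  exactly the elements with values 0 and 1, so that the clopen sets avoiding the designated point
  can be read off from the trunc itself.\<close>

subsection \<open>Disjointness in vector lattices\<close>

text \<open>As simp rules these would rewrite relative complements such as
  \<open>u - inf u v\<close> in terms of negatives; below they have to stay differences.\<close>

declare diff_inf_eq_sup [simp del] diff_sup_eq_inf [simp del]

text \<open>Translations preserve the order. Lowering \<open>x\<close> by \<open>sup b c - d\<close>
  keeps it below \<open>a\<close> and brings it below \<open>d\<close>, hence below
  \<open>m\<close>. Therefore \<open>sup b c - (x - m)\<close> is still an upper bound of
  \<open>b\<close> and \<open>c\<close>, which forces \<open>x - m\<close> to be at most 0.\<close>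

lemma inf_sup_distrib_left:
  fixes a b c :: "'a::vector_lattice"
  shows "inf a (sup b c) = sup (inf a b) (inf a c)"
proof (rule antisym)
  define m where "m = sup (inf a b) (inf a c)"
  define x where "x = inf a (sup b c)"
  have aux: "x - m \<le> sup b c - d" if "d = b \<or> d = c" for d
  proof -
    have "d - sup b c \<le> 0"
      using that by (auto simp only: diff_le_0_iff_le sup_ge1 sup_ge2)
    then have "x + (d - sup b c) \<le> x" using add_left_mono[of _ 0 x] by force
    then have "x + (d - sup b c) \<le> a" unfolding x_def by (meson inf.boundedE order_trans)
    moreover have "x + (d - sup b c) \<le> d"
      unfolding x_def using add_right_mono[OF inf.cobounded2[of a "sup b c"], of "d - sup b c"]
      by (simp add: algebra_simps)
    ultimately have "x + (d - sup b c) \<le> inf a d" by simp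
    also have "\<dots> \<le> m" using that unfolding m_def by auto
    finally show ?thesis by (simp add: algebra_simps)
  qed
  have "b \<le> sup b c - (x - m)" "c \<le> sup b c - (x - m)"
    using aux[of b] aux[of c] by (simp_all add: algebra_simps)
  then have "sup b c \<le> sup b c - (x - m)" by simp
  then show "x \<le> m" by (simp add: algebra_simps)
qed (auto intro: le_infI1 le_infI2)

text \<open>Addition distributes over \<open>inf\<close>, so the right side is the infimum of
  \<open>a + b\<close>, \<open>a + c\<close>, \<open>c + b\<close> and \<open>c + c\<close>. Each of
  these bounds the left side, the terms being nonnegative.\<close>

lemma inf_add_le:
  fixes a b c :: "'a::vector_lattice"
  assumes "0 \<le> a" "0 \<le> b" "0 \<le> c"
  shows "inf (a + b) c \<le> inf a c + inf b c"
proof -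
  define x where "x = inf (a + b) c"
  have "x \<le> c" "x \<le> a + b" unfolding x_def by auto
  then have "x \<le> a + c" "x \<le> c + b" "x \<le> c + c"
    using assms by (metis add_increasing add_increasing2 order_trans)+
  with \<open>x \<le> a + b\<close> show ?thesis
    unfolding x_def[symmetric] by (simp add: add_sup_inf_distribs)
qed

lemma inf_add_eq_0:
  fixes a b c :: "'a::vector_lattice"
  assumes "inf a c = 0" "inf b c = 0"
  shows "inf (a + b) c = 0"
proof -
  have "0 \<le> a" "0 \<le> b" "0 \<le> c" using assms by (metis inf.cobounded1 inf.cobounded2)+
  then show ?thesis using inf_add_le[of a b c] assms by (auto intro: antisym)
qed

lemma scaleR_inf:
  fixes a b :: "'a::vector_lattice"
  assumes "0 < c"
  shows "c *\<^sub>R inf a b = inf (c *\<^sub>R a) (c *\<^sub>R b)"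
proof (rule antisym)
  have "inf (c *\<^sub>R a) (c *\<^sub>R b) /\<^sub>R c \<le> inf a b"
    using assms by (simp add: pos_divideR_le_eq)
  then show "inf (c *\<^sub>R a) (c *\<^sub>R b) \<le> c *\<^sub>R inf a b"
    using assms by (simp only: pos_divideR_le_eq)
qed (use assms in \<open>auto intro: scaleR_left_mono\<close>)

lemma inf_scaleR_eq_0:
  fixes a w :: "'a::vector_lattice"
  assumes "inf a w = 0" "0 \<le> c"
  shows "inf (c *\<^sub>R a) w = 0"
proof -
  have pos: "0 \<le> a" "0 \<le> w" using assms by (metis inf.cobounded1 inf.cobounded2)+
  \<comment> \<open>This choice dominates both \<open>c\<close> and 1 and is positive, so both
    arguments can be scaled by it and \<open>scaleR_inf\<close> applies.\<close>
  define d where "d = c + 1"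
  have "w \<le> d *\<^sub>R w" using scaleR_right_mono[of 1 d w] pos assms(2) by (simp add: d_def)
  moreover have "c *\<^sub>R a \<le> d *\<^sub>R a" using pos by (simp add: d_def scaleR_right_mono)
  ultimately have "inf (c *\<^sub>R a) w \<le> inf (d *\<^sub>R a) (d *\<^sub>R w)" by (rule inf_mono[rotated])
  also have "\<dots> = 0" using assms by (simp add: scaleR_inf[symmetric] d_def)
  finally show ?thesis using pos assms(2) by (auto intro!: antisym scaleR_nonneg_nonneg)
qed

text \<open>\<open>perp w g\<close> says that the absolute value of \<open>g\<close> is disjoint from \<open>w\<close>; the class has no absolute
  value, so a bound \<open>h\<close> takes its place.\<close>

definition perp :: "'a::vector_lattice \<Rightarrow> 'a \<Rightarrow> bool"
  where "perp w g \<longleftrightarrow> (\<exists>h. inf h w = 0 \<and> - h \<le> g \<and> g \<le> h)"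

lemma perp_add:
  assumes "perp w a" "perp w b"
  shows "perp w (a + b)"
proof -
  obtain h k where h: "inf h w = 0" "- h \<le> a" "a \<le> h" and k: "inf k w = 0" "- k \<le> b" "b \<le> k"
    using assms unfolding perp_def by blast
  have "inf (h + k) w = 0" using h k by (simp add: inf_add_eq_0)
  moreover have "- (h + k) \<le> a + b" using add_mono[OF h(2) k(2)] by simp
  moreover have "a + b \<le> h + k" using add_mono[OF h(3) k(3)] by simp
  ultimately show ?thesis unfolding perp_def by blast
qed

lemma perp_uminus: "perp w a \<Longrightarrow> perp w (- a)"
  unfolding perp_def by (metis minus_le_iff neg_le_iff_le)

lemma perp_scaleR:
  assumes "perp w a"
  shows "perp w (c *\<^sub>R a)"
proof -
  have pos: "perp w (c *\<^sub>R b)" if b: "perp w b" and "0 \<le> c" for b c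
  proof -
    obtain h where h: "inf h w = 0" "- h \<le> b" "b \<le> h" using b unfolding perp_def by blast
    have "- (c *\<^sub>R h) \<le> c *\<^sub>R b" using scaleR_left_mono[OF h(2) \<open>0 \<le> c\<close>] by simp
    then show ?thesis
      unfolding perp_def using inf_scaleR_eq_0[OF h(1) \<open>0 \<le> c\<close>] scaleR_left_mono[OF h(3) \<open>0 \<le> c\<close>]
      by blast
  qed
  show ?thesis
  proof (cases "0 \<le> c")
    case False
    then show ?thesis using pos[OF perp_uminus[OF assms], of "- c"] by simp
  qed (use pos assms in blast)
qed

lemma perp_diff: "perp w a \<Longrightarrow> perp w b \<Longrightarrow> perp w (a - b)"
  using perp_add[of w a "- b"] perp_uminus[of w b] by simp

lemma perp_zero: "0 \<le> w \<Longrightarrow> perp w 0"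
  unfolding perp_def by (rule exI[of _ 0]) (simp add: inf_absorb1)

lemma perp_mono:
  assumes "perp v a" "0 \<le> w" "w \<le> v"
  shows "perp w a"
proof -
  obtain h where h: "inf h v = 0" "- h \<le> a" "a \<le> h" using assms unfolding perp_def by blast
  have "0 \<le> h" using h(1) by (metis inf.cobounded1)
  moreover have "inf h w \<le> inf h v" using assms by (simp add: le_infI2)
  ultimately have "inf h w = 0" using h assms by (auto intro: antisym)
  then show ?thesis using h unfolding perp_def by blast
qed

lemma perp_imp_inf_eq_0:
  assumes "perp w a" "0 \<le> a"
  shows "inf a w = 0"
proof -
  obtain h where h: "inf h w = 0" "a \<le> h" using assms unfolding perp_def by blast
  have "0 \<le> w" using h(1) by (metis inf.cobounded2)
  moreover have "inf a w \<le> inf h w" using h(2) by (rule inf_mono) simp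
  ultimately show ?thesis using h(1) assms by (auto intro: antisym)
qed

lemma inf_eq_0_imp_perp: "inf a w = 0 \<Longrightarrow> perp w a"
  unfolding perp_def
  by (rule exI[of _ a]) (metis inf.cobounded1 minus_le_iff neg_0_le_iff_le neg_le_0_iff_le order.refl order_trans)

lemma perp_self: "perp w w \<Longrightarrow> w = 0"
  unfolding perp_def
  by (metis inf.absorb2)

lemma sup_le_sup_add:
  fixes a b :: "'a::vector_lattice"
  assumes "a \<le> a' + h" "b \<le> b' + k" "0 \<le> h" "0 \<le> k"
  shows "sup a b \<le> sup a' b' + (h + k)"
proof (rule sup_least)
  show "a \<le> sup a' b' + (h + k)"
    using assms by (smt (verit, ccfv_SIG) add.assoc add_increasing2 add_right_mono order_trans sup_ge1)
  show "b \<le> sup a' b' + (h + k)"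
    using assms by (smt (verit, ccfv_SIG) add.assoc add.commute add_increasing2 add_right_mono order_trans sup_ge2)
qed

text \<open>The difference is bounded by \<open>h + k\<close>, which is still disjoint from
  \<open>w\<close>. In other words, \<open>sup\<close> is well defined modulo the elements disjoint
  from \<open>w\<close>.\<close>

lemma perp_sup_diff:
  assumes "perp w (a - a')" "perp w (b - b')"
  shows "perp w (sup a b - sup a' b')"
proof -
  obtain h where h: "inf h w = 0" "- h \<le> a - a'" "a - a' \<le> h"
    using assms(1) unfolding perp_def by blast
  obtain k where k: "inf k w = 0" "- k \<le> b - b'" "b - b' \<le> k"
    using assms(2) unfolding perp_def by blast
  have "0 \<le> h" "0 \<le> k" using h k by (metis inf.cobounded1)+
  then have "sup a b \<le> sup a' b' + (h + k)" "sup a' b' \<le> sup a b + (h + k)"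
    using h k by (intro sup_le_sup_add; simp add: algebra_simps)+
  then have "sup a b - sup a' b' \<le> h + k" "- (h + k) \<le> sup a b - sup a' b'"
    by (metis add.commute diff_le_eq, metis add.commute diff_le_eq minus_diff_eq neg_le_iff_le)
  then show ?thesis unfolding perp_def using inf_add_eq_0[OF h(1) k(1)] by blast
qed

lemma inf_eq_add_diff_sup:
  fixes a b :: "'a::vector_lattice"
  shows "inf a b = a + b - sup a b"
  by (metis add_diff_cancel_left' add_eq_inf_sup)

lemma sup_scaleR_max:
  fixes w :: "'a::vector_lattice"
  assumes "0 \<le> w"
  shows "sup (c *\<^sub>R w) (d *\<^sub>R w) = max c d *\<^sub>R w"
  using assms by (cases "c \<le> d") (auto simp: sup_absorb1 sup_absorb2 scaleR_right_mono)

text \<open>The rest \<open>g - f\<close> splits as \<open>(g - h) + (h - f)\<close>, and both parts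
  are disjoint from \<open>f\<close>.\<close>

lemma component_of_trans:
  assumes "component_of f h" "component_of h g"
  shows "component_of f g"
proof -
  have f: "0 \<le> f" "f \<le> h" "inf f (h - f) = 0" and h: "0 \<le> g" "h \<le> g" "inf h (g - h) = 0"
    using assms unfolding component_of_def by auto
  have "inf f (g - h) \<le> inf h (g - h)" using f by (simp add: le_infI1)
  then have "inf f (g - h) = 0" using f h by (auto intro: antisym)
  then have "inf ((g - h) + (h - f)) f = 0" using f by (intro inf_add_eq_0) (auto simp: inf_commute)
  then show ?thesis
    using f h unfolding component_of_def by (auto simp: inf_commute)
qed

lemma component_of_sup:
  assumes "component_of a g" "component_of b g"
  shows "component_of (sup a b) g"
proof -
  have a: "0 \<le> a" "0 \<le> g" "a \<le> g" "inf a (g - a) = 0" and b: "b \<le> g" "inf b (g - b) = 0" "0 \<le> b"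
    using assms unfolding component_of_def by auto
  have "inf a (g - sup a b) \<le> inf a (g - a)" "inf b (g - sup a b) \<le> inf b (g - b)"
    by (auto simp: le_infI2)
  then have "inf (sup a b) (g - sup a b) \<le> 0"
    using a b inf_sup_distrib_left[of "g - sup a b" a b]
    by (simp only: inf_commute[of _ "g - sup a b"] le_sup_iff)
  then show ?thesis
    using a b unfolding component_of_def
    by (auto intro: antisym simp only: le_inf_iff diff_ge_0_iff_ge le_supI1 le_sup_iff)
qed

text \<open>The rest of \<open>g\<close> is \<open>(g - q) + p\<close>. Both summands are disjoint
  from \<open>q - p\<close>, which lies below \<open>q\<close> and below
  \<open>g - p\<close>.\<close>

lemma component_of_diff:
  assumes p: "component_of p g" and q: "component_of q g" and "p \<le> q"
  shows "component_of (q - p) g"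
proof -
  have p: "0 \<le> p" "0 \<le> g" "p \<le> g" "inf p (g - p) = 0" and q: "q \<le> g" "inf q (g - q) = 0"
    using p q unfolding component_of_def by auto
  have "inf (g - q) (q - p) \<le> inf q (g - q)"
    using p by (auto intro: le_infI1 le_infI2)
  moreover have "inf p (q - p) \<le> inf p (g - p)"
    using q by (auto intro: le_infI2 diff_right_mono)
  ultimately have "inf (g - q) (q - p) = 0" "inf p (q - p) = 0"
    using p q \<open>p \<le> q\<close> by (auto intro!: antisym)
  then have "inf ((g - q) + p) (q - p) = 0" by (rule inf_add_eq_0)
  moreover have "(g - q) + p = g - (q - p)" by simp
  moreover have "q - p \<le> g" using p q by (metis diff_le_eq add_increasing2 order_trans)
  ultimately show ?thesis
    using p \<open>p \<le> q\<close> unfolding component_of_def by (simp add: inf_commute)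
qed

lemma component_of_imp_sup_diff:
  assumes "component_of f g"
  shows "sup f (g - f) = g"
  using assms add_eq_inf_sup[of f "g - f"] unfolding component_of_def by simp

subsection \<open>Unital components\<close>

context trunc
begin

text \<open>The axiom \<open>inf_tr_le\<close> is used in both directions. Being able to move
  \<open>tr\<close> across \<open>inf\<close> is what yields monotonicity and nonexpansiveness
  below.\<close>

lemma inf_tr_commute:
  assumes "0 \<le> g" "0 \<le> h"
  shows "inf g (tr h) = inf (tr g) h"
proof (rule antisym)
  show "inf g (tr h) \<le> inf (tr g) h"
    using inf_tr_le[OF assms] le_infI2[OF tr_le[OF assms(2)]] by simp
  show "inf (tr g) h \<le> inf g (tr h)"
    using inf_tr_le[OF assms(2,1)] le_infI1[OF tr_le[OF assms(1)]] by (simp add: inf_commute)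
qed

lemma tr_of_le_tr:
  assumes "0 \<le> f" "f \<le> tr g" "0 \<le> g"
  shows "tr f = f"
  using inf_tr_le[OF assms(1,3)] tr_le[OF assms(1)] assms(2) by (simp add: inf_absorb1)

lemma tr_tr: "0 \<le> g \<Longrightarrow> tr (tr g) = tr g"
  by (rule tr_of_le_tr[of _ g]) (auto simp: tr_nonneg)

lemma truncated_iff: "g \<in> truncated tr \<longleftrightarrow> 0 \<le> g \<and> tr g = g"
  unfolding truncated_def by (auto simp: tr_nonneg tr_tr intro!: image_eqI)

lemma truncated_le: "g \<in> truncated tr \<Longrightarrow> 0 \<le> f \<Longrightarrow> f \<le> g \<Longrightarrow> f \<in> truncated tr"
  using tr_of_le_tr[of f g] by (auto simp: truncated_iff)

lemma tr_mono:
  assumes "0 \<le> g" "g \<le> h"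
  shows "tr g \<le> tr h"
proof -
  have "0 \<le> h" using assms by simp
  have "tr g \<le> g" using tr_le assms(1) .
  then have "tr g = inf (tr g) h" using assms by (simp add: inf_absorb1)
  also have "\<dots> = inf g (tr h)" using inf_tr_commute assms(1) \<open>0 \<le> h\<close> by metis
  finally show ?thesis by (metis inf.cobounded2)
qed

lemma truncated_sup:
  assumes "g \<in> truncated tr" "h \<in> truncated tr"
  shows "sup g h \<in> truncated tr"
proof -
  have "0 \<le> g" "0 \<le> h" "tr g = g" "tr h = h" using assms by (auto simp: truncated_iff)
  moreover have "0 \<le> sup g h" using \<open>0 \<le> g\<close> by (simp add: le_supI1)
  ultimately have "tr (sup g h) = sup g h"
    using tr_mono[of g "sup g h"] tr_mono[of h "sup g h"] tr_le[of "sup g h"] by (auto intro: antisym)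
  with \<open>0 \<le> sup g h\<close> show ?thesis by (simp add: truncated_iff)
qed

text \<open>Split \<open>a\<close> into \<open>inf a g\<close> and the excess
  \<open>sup a g - g\<close>. Moving the truncation across \<open>inf\<close> turns the first part
  into \<open>tr g\<close>; the excess is at most \<open>h\<close>, since \<open>a\<close> and
  \<open>g\<close> both lie below \<open>g + h\<close>.\<close>

lemma tr_add_le:
  assumes "0 \<le> g" "0 \<le> h"
  shows "tr (g + h) \<le> tr g + h"
proof -
  define a where "a = tr (g + h)"
  have gh: "0 \<le> g + h" "g \<le> g + h" using assms by auto
  have "inf a g = inf (g + h) (tr g)"
    unfolding a_def using inf_tr_commute[OF gh(1) assms(1)] by simp
  also have "\<dots> = tr g" using tr_le[OF assms(1)] gh(2) by (intro inf_absorb2) (rule order_trans)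
  finally have *: "inf a g = tr g" .
  have "a \<le> g + h" unfolding a_def using tr_le gh by blast
  then have "sup a g - g \<le> h" using assms by (simp add: algebra_simps)
  moreover have "a = inf a g + (sup a g - g)"
    using add_eq_inf_sup[of a g] by (simp add: algebra_simps)
  ultimately show ?thesis unfolding a_def[symmetric] * by (metis add_left_mono)
qed

lemma perp_tr_diff:
  assumes "perp w (g - h)" "0 \<le> g" "0 \<le> h"
  shows "perp w (tr g - tr h)"
proof -
  obtain k where k: "inf k w = 0" "- k \<le> g - h" "g - h \<le> k"
    using assms(1) unfolding perp_def by blast
  have "0 \<le> k" using k by (metis inf.cobounded1)
  have "g \<le> h + k" "h \<le> g + k" using k by (auto simp: algebra_simps)
  then have "tr g \<le> tr h + k" "tr h \<le> tr g + k"
    using tr_mono tr_add_le assms \<open>0 \<le> k\<close> by (meson order_trans)+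
  then have "- k \<le> tr g - tr h" "tr g - tr h \<le> k" by (simp_all add: algebra_simps)
  with k show ?thesis unfolding perp_def by blast
qed

section \<open>The generalized Boolean algebra of unital components\<close>

abbreviation unitals :: "'g set"
  where "unitals \<equiv> {u. unital_component tr u}"

lemma unital_truncated: "u \<in> unitals \<Longrightarrow> u \<in> truncated tr"
  by (simp add: unital_component_def)

lemma unital_nonneg: "u \<in> unitals \<Longrightarrow> 0 \<le> u"
  using unital_truncated truncated_iff by blast

lemma unital_component_inf:
  "u \<in> unitals \<Longrightarrow> g \<in> truncated tr \<Longrightarrow> component_of (inf u g) g"
  by (simp add: unital_component_def)

lemma zero_unital: "0 \<in> unitals"
proof -
  have "tr 0 = 0" using tr_le[of 0] tr_nonneg[of 0] by simp
  then show ?thesis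
    unfolding unital_component_def by (auto simp: truncated_iff component_of_def inf_absorb1)
qed

text \<open>Since \<open>inf v g\<close> is again truncated, \<open>u\<close> cuts a component out
  of it, and being a component is transitive.\<close>

lemma inf_unital:
  assumes "u \<in> unitals" "v \<in> unitals"
  shows "inf u v \<in> unitals"
proof -
  have "component_of (inf (inf u v) g) g" if g: "g \<in> truncated tr" for g
  proof -
    have "0 \<le> g" using g truncated_iff by blast
    then have "inf v g \<in> truncated tr"
      using truncated_le[OF g] unital_nonneg[OF assms(2)] by simp
    then show ?thesis
      using component_of_trans unital_component_inf assms g by (metis inf_assoc)
  qed
  then show ?thesis
    using truncated_le[of u "inf u v"] assms unital_nonneg by (auto simp: unital_component_def)
qed

lemma sup_unital:
  assumes "u \<in> unitals" "v \<in> unitals"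
  shows "sup u v \<in> unitals"
proof -
  have "component_of (inf (sup u v) g) g" if "g \<in> truncated tr" for g
  proof -
    have "inf (sup u v) g = sup (inf u g) (inf v g)"
      using inf_sup_distrib_left[of g u v] by (simp only: inf_commute)
    then show ?thesis
      using component_of_sup[OF unital_component_inf[OF assms(1) that] unital_component_inf[OF assms(2) that]]
      by (simp only:)
  qed
  then show ?thesis
    using truncated_sup[OF unital_truncated[OF assms(1)] unital_truncated[OF assms(2)]]
    unfolding unital_component_def by blast
qed

text \<open>The element \<open>u\<close> is the disjoint supremum of \<open>b\<close> and
  \<open>a\<close>. Meeting with \<open>g\<close> preserves this, so \<open>inf a g\<close> is a
  difference of two nested components of \<open>g\<close>.\<close>

lemma diff_unital:
  assumes "u \<in> unitals" "v \<in> unitals"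
  shows "u - inf u v \<in> unitals"
proof -
  define a where "a = u - inf u v"
  define b where "b = inf u v"
  have b: "b \<in> unitals" unfolding b_def using assms by (rule inf_unital)
  have pos: "0 \<le> a" "0 \<le> b" "a \<le> u" "b \<le> u"
    unfolding a_def b_def[symmetric] using unital_nonneg[OF b] by (simp_all add: b_def del: diff_inf_eq_sup)
  have "component_of b u"
    unfolding b_def using unital_component_inf[OF assms(2)] unital_truncated[OF assms(1)]
    by (metis inf_commute)
  then have ab: "inf b a = 0" "sup b a = u"
    using component_of_imp_sup_diff[of b u] unfolding a_def b_def component_of_def by auto
  have "component_of (inf a g) g" if g: "g \<in> truncated tr" for g
  proof -
    have "0 \<le> g" using g truncated_iff by blast
    have "inf (inf b g) (inf a g) \<le> inf b a" by (rule inf_mono) simp_all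
    then have "inf (inf b g) (inf a g) = 0"
      using ab pos \<open>0 \<le> g\<close> by (auto intro!: antisym)
    moreover have "sup (inf b g) (inf a g) = inf u g"
      using ab inf_sup_distrib_left[of g b a] by (simp add: inf_commute)
    ultimately have "inf a g = inf u g - inf b g"
      using add_eq_inf_sup[of "inf b g" "inf a g"] by (simp add: algebra_simps)
    moreover have "inf b g \<le> inf u g" using pos(4) by (rule inf_mono) simp
    ultimately show ?thesis
      using component_of_diff[OF unital_component_inf[OF b g] unital_component_inf[OF assms(1) g]] by simp
  qed
  then show ?thesis
    unfolding a_def[symmetric] unital_component_def
    using truncated_le[OF unital_truncated[OF assms(1)]] pos by blast
qed

lemma unital_component_of:
  assumes "w \<in> unitals" "v \<in> unitals" "w \<le> v"
  shows "component_of w v"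
  using unital_component_inf[OF assms(1) unital_truncated[OF assms(2)]] assms(3)
  by (simp add: inf_absorb1)

text \<open>Multiples up to 1 lie below \<open>u\<close> and are truncated. For larger
  \<open>c\<close>, \<open>u\<close> is a component of \<open>t\<close>, so the excess
  \<open>t - u\<close> is disjoint from \<open>u\<close>; being bounded by a multiple of
  \<open>u\<close>, it is zero. This is where truncation becomes the minimum with 1.\<close>

lemma tr_scaleR_unital:
  assumes "u \<in> unitals" "0 \<le> c"
  shows "tr (c *\<^sub>R u) = min c 1 *\<^sub>R u"
proof (cases "c \<le> 1")
  case True
  then have "c *\<^sub>R u \<le> u" using scaleR_right_mono[of c 1 u] unital_nonneg[OF assms(1)] by simp
  then have "c *\<^sub>R u \<in> truncated tr"
    using truncated_le[OF unital_truncated[OF assms(1)]] unital_nonneg[OF assms(1)] assms(2)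
    by (simp add: scaleR_nonneg_nonneg)
  then show ?thesis using True by (simp add: truncated_iff)
next
  case False
  define t where "t = tr (c *\<^sub>R u)"
  have u: "0 \<le> u" "tr u = u" using unital_truncated[OF assms(1)] by (auto simp: truncated_iff)
  then have cu: "0 \<le> c *\<^sub>R u" "u \<le> c *\<^sub>R u"
    using assms(2) False scaleR_right_mono[of 1 c u] by (auto simp: scaleR_nonneg_nonneg)
  have "inf u t = u"
    unfolding t_def using inf_tr_commute[OF u(1) cu(1)] cu u by (simp add: inf_absorb1)
  moreover have "t \<in> truncated tr" unfolding t_def truncated_def using cu by blast
  ultimately have ut: "u \<le> t" "inf (t - u) u = 0"
    using unital_component_inf[OF assms(1), of t] unfolding component_of_def
    by (auto simp: inf_commute)
  have "t - u \<le> (c - 1) *\<^sub>R u"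
    using tr_le[OF cu(1)] unfolding t_def by (simp add: algebra_simps)
  moreover have "inf ((c - 1) *\<^sub>R u) (t - u) = 0"
    using inf_scaleR_eq_0[of u "t - u" "c - 1"] ut False by (simp add: inf_commute)
  ultimately have "t - u = 0" by (simp add: inf_absorb2)
  then show ?thesis using False unfolding t_def by simp
qed

end

subsection \<open>Prime filters and values\<close>

context trunc
begin

text \<open>Every condition is an equivalence between memberships of at most three elements, which
  later makes the spectrum closed in a cube. Upward closure is contained in the clause for
  \<open>inf\<close>.\<close>

definition spectrum :: "'g set set"
  where "spectrum = {F. F \<subseteq> unitals \<and> 0 \<notin> F \<and>
    (\<forall>u \<in> unitals. \<forall>v \<in> unitals.
      (inf u v \<in> F \<longleftrightarrow> u \<in> F \<and> v \<in> F) \<and> (sup u v \<in> F \<longleftrightarrow> u \<in> F \<or> v \<in> F))}"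

lemma spectrumD:
  assumes "F \<in> spectrum"
  shows "F \<subseteq> unitals" "0 \<notin> F"
    and "\<lbrakk>u \<in> unitals; v \<in> unitals\<rbrakk> \<Longrightarrow> inf u v \<in> F \<longleftrightarrow> u \<in> F \<and> v \<in> F"
    and "\<lbrakk>u \<in> unitals; v \<in> unitals\<rbrakk> \<Longrightarrow> sup u v \<in> F \<longleftrightarrow> u \<in> F \<or> v \<in> F"
  using assms unfolding spectrum_def by blast+

lemma empty_spectrum: "{} \<in> spectrum"
  unfolding spectrum_def by simp

lemma unital_diff_disjoint:
  assumes "u \<in> unitals" "v \<in> unitals"
  shows "inf (u - inf u v) v = 0" "sup (inf u v) (u - inf u v) = u"
proof -
  define b where "b = inf u v"
  have "component_of b u"
    using unital_component_of[OF inf_unital[OF assms] assms(1)] unfolding b_def by simp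
  then have b: "inf b (u - b) = 0" "sup b (u - b) = u" "0 \<le> b"
    using component_of_imp_sup_diff[of b u] unfolding component_of_def by auto
  then show "sup (inf u v) (u - inf u v) = u" unfolding b_def by simp
  have "inf (u - b) v = inf (u - b) (inf u v)"
    using b(3) by (simp add: inf_assoc[symmetric] inf_absorb1)
  then show "inf (u - inf u v) v = 0"
    using b(1) unfolding b_def by (simp add: inf_commute)
qed

text \<open>Primeness decides between the two disjoint parts of \<open>u\<close>. The use of this is
  to trade a non-membership for a membership.\<close>

lemma spectrum_diff_iff:
  assumes F: "F \<in> spectrum" and uv: "u \<in> unitals" "v \<in> unitals"
  shows "u - inf u v \<in> F \<longleftrightarrow> u \<in> F \<and> v \<notin> F"
  using spectrumD(2)[OF F] spectrumD(3)[OF F diff_unital[OF uv] uv(2)]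
    spectrumD(3)[OF F uv] spectrumD(4)[OF F inf_unital[OF uv] diff_unital[OF uv]]
  unfolding unital_diff_disjoint[OF uv] by blast

text \<open>The complement of an ideal of unital components that is maximal among those containing
  \<open>I\<close> but not \<open>u\<close> is a point of the spectrum.\<close>

lemma spectrum_separation:
  assumes u: "u \<in> unitals" "u \<notin> I" and I: "0 \<in> I" "I \<subseteq> unitals"
    and down: "\<And>v w. \<lbrakk>v \<in> I; w \<in> unitals; w \<le> v\<rbrakk> \<Longrightarrow> w \<in> I"
    and sup: "\<And>v w. \<lbrakk>v \<in> I; w \<in> I\<rbrakk> \<Longrightarrow> sup v w \<in> I"
  obtains F where "F \<in> spectrum" "u \<in> F" "F \<inter> I = {}"
proof -
  define A where "A = {J. I \<subseteq> J \<and> J \<subseteq> unitals \<and> u \<notin> J \<and>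
    (\<forall>v\<in>J. \<forall>w\<in>unitals. w \<le> v \<longrightarrow> w \<in> J) \<and> (\<forall>v\<in>J. \<forall>w\<in>J. sup v w \<in> J)}"
  have "I \<in> A" unfolding A_def using assms by blast
  have "\<exists>J\<in>A. \<forall>K\<in>A. J \<subseteq> K \<longrightarrow> K = J"
  proof (rule subset_Zorn_nonempty)
    fix C assume C: "C \<noteq> {}" "subset.chain A C"
    have CA: "\<And>J. J \<in> C \<Longrightarrow> J \<in> A" and ch: "\<And>J K. J \<in> C \<Longrightarrow> K \<in> C \<Longrightarrow> J \<subseteq> K \<or> K \<subseteq> J"
      using C(2) unfolding subset_chain_def by blast+
    have "sup v w \<in> \<Union>C" if vw: "v \<in> \<Union>C" "w \<in> \<Union>C" for v w
    proof -
      obtain J K where "v \<in> J" "J \<in> C" "w \<in> K" "K \<in> C" using vw by blast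
      moreover from this have "J \<subseteq> K \<or> K \<subseteq> J" using ch by simp
      ultimately obtain L where "L \<in> C" "v \<in> L" "w \<in> L" by (meson subsetD)
      then show ?thesis using CA[of L] unfolding A_def by blast
    qed
    moreover have "I \<subseteq> \<Union>C"
    proof -
      obtain J where "J \<in> C" using C(1) by blast
      moreover from this have "I \<subseteq> J" using CA unfolding A_def by blast
      ultimately show ?thesis by blast
    qed
    moreover have "\<Union>C \<subseteq> unitals" "u \<notin> \<Union>C" using CA unfolding A_def by blast+
    moreover have "w \<in> \<Union>C" if vw: "v \<in> \<Union>C" "w \<in> unitals" "w \<le> v" for v w
    proof -
      obtain J where "J \<in> C" "v \<in> J" using vw(1) by blast
      moreover from this have "w \<in> J" using CA[of J] vw(2,3) unfolding A_def by blast
      ultimately show ?thesis by blast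
    qed
    ultimately show "\<Union>C \<in> A" unfolding A_def by blast
  qed (use \<open>I \<in> A\<close> in blast)
  then obtain J where JA: "J \<in> A" and max: "\<And>K. K \<in> A \<Longrightarrow> J \<subseteq> K \<Longrightarrow> K = J" by blast
  have J: "I \<subseteq> J" "J \<subseteq> unitals" "u \<notin> J"
    and Jd: "\<And>v w. v \<in> J \<Longrightarrow> w \<in> unitals \<Longrightarrow> w \<le> v \<Longrightarrow> w \<in> J"
    and Js: "\<And>v w. v \<in> J \<Longrightarrow> w \<in> J \<Longrightarrow> sup v w \<in> J"
    using JA unfolding A_def by blast+
  have "0 \<in> J" using I J by blast
  \<comment> \<open>Otherwise \<open>K\<close>, the ideal generated by \<open>J\<close> and
    \<open>a\<close>, would still avoid \<open>u\<close>, against maximality.\<close>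
  have bound: "\<exists>j\<in>J. u \<le> sup j a" if a: "a \<in> unitals" "a \<notin> J" for a
  proof (rule ccontr)
    assume no: "\<not> ?thesis"
    define K where "K = {w \<in> unitals. \<exists>j\<in>J. w \<le> sup j a}"
    have "sup v w \<in> K" if vw: "v \<in> K" "w \<in> K" for v w
    proof -
      obtain i j where "i \<in> J" "v \<le> sup i a" "j \<in> J" "w \<le> sup j a"
        using vw unfolding K_def by blast
      moreover from this have "sup v w \<le> sup (sup i j) a"
        using sup_mono[of v "sup i a" w "sup j a"] by (simp add: sup.assoc sup.left_commute sup.commute)
      ultimately show ?thesis
        using vw sup_unital[of v w] Js[of i j] unfolding K_def by blast
    qed
    moreover have JK: "J \<subseteq> K"
    proof
      fix j assume "j \<in> J"
      moreover have "j \<le> sup j a" by simp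
      ultimately show "j \<in> K" unfolding K_def using J(2) by blast
    qed
    moreover have "u \<notin> K" using no unfolding K_def by blast
    moreover have "\<forall>v\<in>K. \<forall>w\<in>unitals. w \<le> v \<longrightarrow> w \<in> K"
      unfolding K_def by (blast intro: order_trans)
    moreover have "K \<subseteq> unitals" unfolding K_def by blast
    moreover have "I \<subseteq> K" using J(1) JK by (rule order_trans)
    ultimately have "K \<in> A" unfolding A_def by blast
    moreover have "a \<in> K" unfolding K_def using a(1) \<open>0 \<in> J\<close> by auto
    ultimately show False using max JK a(2) by blast
  qed
  define F where "F = unitals - J"
  have "F \<in> spectrum"
  proof -
    have "a \<in> J \<or> b \<in> J" if ab: "a \<in> unitals" "b \<in> unitals" "inf a b \<in> J" for a b
    proof (rule ccontr)
      assume "\<not> ?thesis"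
      then obtain i j where i: "i \<in> J" "u \<le> sup i a" and j: "j \<in> J" "u \<le> sup j b"
        using bound ab by blast
      \<comment> \<open>By distributivity the meet of the two bounds on \<open>u\<close> lies below
        \<open>?k\<close>, which belongs to \<open>J\<close>; this would put \<open>u\<close> into
        \<open>J\<close>.\<close>
      let ?k = "sup (sup i j) (inf a b)"
      have "u \<le> inf (sup i a) (sup j b)" using i j by simp
      also have "\<dots> \<le> ?k"
      proof -
        have "inf (sup i a) (sup j b) = sup (inf (sup i a) j) (sup (inf b i) (inf b a))"
          using inf_sup_distrib_left[of "sup i a" j b] inf_sup_distrib_left[of b i a]
          by (simp only: inf_commute)
        also have "\<dots> \<le> ?k"
          by (simp add: inf_commute[of b a] le_infI2 le_supI1 le_supI2)
        finally show ?thesis .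
      qed
      finally have "u \<le> ?k" .
      then show False using Jd[of ?k u] Js i j ab(3) J(3) u(1) by blast
    qed
    moreover have "inf a b \<in> J" if "a \<in> unitals" "b \<in> unitals" "a \<in> J \<or> b \<in> J" for a b
      using that(3) Jd[of a "inf a b"] Jd[of b "inf a b"] inf_unital[OF that(1,2)] by auto
    moreover have "a \<in> J \<and> b \<in> J" if "a \<in> unitals" "b \<in> unitals" "sup a b \<in> J" for a b
      using Jd[OF that(3,1)] Jd[OF that(3,2)] by simp
    ultimately have J_iff: "inf a b \<in> J \<longleftrightarrow> a \<in> J \<or> b \<in> J" "sup a b \<in> J \<longleftrightarrow> a \<in> J \<and> b \<in> J"
      if "a \<in> unitals" "b \<in> unitals" for a b
      using that Js[of a b] by metis+
    show ?thesis
      unfolding spectrum_def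
    proof (intro CollectI conjI ballI)
      show "F \<subseteq> unitals" "0 \<notin> F" unfolding F_def using \<open>0 \<in> J\<close> by blast+
      fix a b assume ab: "a \<in> unitals" "b \<in> unitals"
      show "inf a b \<in> F \<longleftrightarrow> a \<in> F \<and> b \<in> F" "sup a b \<in> F \<longleftrightarrow> a \<in> F \<or> b \<in> F"
        using ab inf_unital[OF ab] sup_unital[OF ab] J_iff[OF ab] unfolding F_def by blast+
    qed
  qed
  then show thesis
    using that[of F] u J unfolding F_def by blast
qed

section \<open>Values at a prime filter\<close>

definition value_at :: "'g set \<Rightarrow> 'g \<Rightarrow> real \<Rightarrow> bool"
  where "value_at F g c \<longleftrightarrow> (\<exists>v \<in> F. perp v (g - c *\<^sub>R v))"

text \<open>As \<open>w\<close> is a component of \<open>v\<close>, the correction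
  \<open>c *\<^sub>R (v - w)\<close> is disjoint from \<open>w\<close>. So the witness of a value
  may be shrunk, and two values can be compared on the infimum of their witnesses.\<close>

lemma perp_unital_mono:
  assumes "perp v (g - c *\<^sub>R v)" "v \<in> unitals" "w \<in> unitals" "w \<le> v"
  shows "perp w (g - c *\<^sub>R w)"
proof -
  have "inf (v - w) w = 0"
    using unital_component_of[OF assms(3,2,4)] unfolding component_of_def by (simp add: inf_commute)
  then have "perp w (c *\<^sub>R (v - w))" by (intro perp_scaleR inf_eq_0_imp_perp)
  moreover have "perp w (g - c *\<^sub>R v)"
    using perp_mono[OF assms(1)] unital_nonneg[OF assms(3)] assms(4) by blast
  ultimately show ?thesis using perp_add[of w "g - c *\<^sub>R v" "c *\<^sub>R (v - w)"] by (simp add: algebra_simps)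
qed

lemma value_at_common:
  assumes F: "F \<in> spectrum" and "value_at F g c" "value_at F h d"
  obtains w where "w \<in> F" "w \<in> unitals" "0 \<le> w" "perp w (g - c *\<^sub>R w)" "perp w (h - d *\<^sub>R w)"
proof -
  obtain u v where u: "u \<in> F" "perp u (g - c *\<^sub>R u)" and v: "v \<in> F" "perp v (h - d *\<^sub>R v)"
    using assms unfolding value_at_def by blast
  have U: "u \<in> unitals" "v \<in> unitals" using u v spectrumD(1)[OF F] by blast+
  note w = inf_unital[OF U]
  show thesis
  proof (rule that[of "inf u v"])
    show "inf u v \<in> F" using spectrumD(3)[OF F U] u v by simp
  qed (use w unital_nonneg[OF w] perp_unital_mono[OF u(2) U(1) w] perp_unital_mono[OF v(2) U(2) w] in auto)
qed

lemma value_at_unique: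
  assumes F: "F \<in> spectrum" and "value_at F g c" "value_at F g d"
  shows "c = d"
proof (rule ccontr)
  assume "c \<noteq> d"
  obtain w where w: "w \<in> F" "perp w (g - c *\<^sub>R w)" "perp w (g - d *\<^sub>R w)"
    using value_at_common[OF assms] by blast
  have "perp w ((d - c) *\<^sub>R w)" using perp_diff[OF w(2,3)] by (simp add: algebra_simps)
  then have "perp w ((1 / (d - c)) *\<^sub>R (d - c) *\<^sub>R w)" by (rule perp_scaleR)
  then have "perp w w" using \<open>c \<noteq> d\<close> by simp
  then have "w = 0" by (rule perp_self)
  then show False using w(1) spectrumD(2)[OF F] by blast
qed

lemma value_at_add:
  assumes "F \<in> spectrum" "value_at F g c" "value_at F h d"
  shows "value_at F (g + h) (c + d)"
proof -
  obtain w where w: "w \<in> F" "perp w (g - c *\<^sub>R w)" "perp w (h - d *\<^sub>R w)"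
    using value_at_common[OF assms] by blast
  then show ?thesis
    using perp_add[OF w(2,3)] unfolding value_at_def by (auto simp: algebra_simps)
qed

lemma value_at_scaleR: "value_at F g c \<Longrightarrow> value_at F (a *\<^sub>R g) (a * c)"
  unfolding value_at_def using perp_scaleR[of _ "g - c *\<^sub>R _" a] by (auto simp: algebra_simps)

lemma value_at_sup:
  assumes "F \<in> spectrum" "value_at F g c" "value_at F h d"
  shows "value_at F (sup g h) (max c d)"
proof -
  obtain w where w: "w \<in> F" "0 \<le> w" "perp w (g - c *\<^sub>R w)" "perp w (h - d *\<^sub>R w)"
    using value_at_common[OF assms] by blast
  then show ?thesis
    using perp_sup_diff[OF w(3,4)] unfolding value_at_def by (auto simp: sup_scaleR_max)
qed

lemma value_at_unital_mem: "F \<in> spectrum \<Longrightarrow> u \<in> F \<Longrightarrow> value_at F u 1"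
  unfolding value_at_def using spectrumD(1) unital_nonneg by (force intro: perp_zero)

text \<open>For a member \<open>w\<close> of \<open>F\<close>, the part of \<open>w\<close> outside
  \<open>u\<close> is also a member, and it is disjoint from \<open>u\<close>. The empty filter
  offers no such \<open>w\<close>.\<close>

lemma value_at_unital_not_mem:
  assumes F: "F \<in> spectrum" "F \<noteq> {}" and u: "u \<in> unitals" "u \<notin> F"
  shows "value_at F u 0"
proof -
  obtain w where w: "w \<in> F" "w \<in> unitals" using F spectrumD(1) by blast
  have "w - inf w u \<in> F" using spectrum_diff_iff[OF F(1) w(2) u(1)] w u by blast
  moreover have "perp (w - inf w u) u"
    using unital_diff_disjoint(1)[OF w(2) u(1)] by (simp add: inf_eq_0_imp_perp inf_commute)
  ultimately show ?thesis unfolding value_at_def by auto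
qed

lemma value_at_tr:
  assumes F: "F \<in> spectrum" and g: "value_at F g c" "0 \<le> g" "0 \<le> c"
  shows "value_at F (tr g) (min c 1)"
proof -
  obtain w where w: "w \<in> F" "perp w (g - c *\<^sub>R w)" using g unfolding value_at_def by blast
  have U: "w \<in> unitals" using w spectrumD(1)[OF F] by blast
  have "perp w (tr g - tr (c *\<^sub>R w))"
    using perp_tr_diff[OF w(2) g(2)] g(3) unital_nonneg[OF U] by (simp add: scaleR_nonneg_nonneg)
  then show ?thesis
    using w(1) tr_scaleR_unital[OF U g(3)] unfolding value_at_def by auto
qed

end

section \<open>The embedding into functions on the spectrum\<close>

context simple_trunc
begin

lemma value_at_exists:
  assumes F: "F \<in> spectrum" "F \<noteq> {}"
  shows "\<exists>c. value_at F g c"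
proof -
  have "g \<in> span unitals" by (rule simple)
  then show ?thesis
  proof (induction rule: span_induct_alt)
    case base
    obtain w where "w \<in> F" using F by blast
    then show ?case
      using value_at_scaleR[OF value_at_unital_mem[OF F(1)], of w 0] by auto
  next
    case (step c u g)
    have "\<exists>d. value_at F u d"
      using value_at_unital_mem[OF F(1)] value_at_unital_not_mem[OF F step(1)] by blast
    then show ?case using step(2) value_at_add[OF F(1) value_at_scaleR] by blast
  qed
qed

text \<open>At the empty filter \<open>value_at\<close> never holds, so 0 is imposed at this
  designated point. Off the spectrum, 0 matches the convention of
  \<open>loc_const_functions\<close>.\<close>

definition eval :: "'a \<Rightarrow> 'a set \<Rightarrow> real"
  where "eval g F = (if F \<in> spectrum \<and> F \<noteq> {} then THE c. value_at F g c else 0)"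

lemma value_at_eval: "F \<in> spectrum \<Longrightarrow> F \<noteq> {} \<Longrightarrow> value_at F g (eval g F)"
  unfolding eval_def using theI'[of "value_at F g"] value_at_exists[of F g] value_at_unique[of F g]
  by auto

lemma eval_eqI: "F \<in> spectrum \<Longrightarrow> value_at F g c \<Longrightarrow> eval g F = c"
  using value_at_eval[of F g] value_at_unique[of F g] by (auto simp: value_at_def)

lemma eval_outside: "F \<notin> spectrum \<or> F = {} \<Longrightarrow> eval g F = 0"
  by (auto simp: eval_def)

lemma eval_add: "eval (g + h) F = eval g F + eval h F"
  by (cases "F \<in> spectrum \<and> F \<noteq> {}")
    (auto simp: eval_outside intro!: eval_eqI value_at_add value_at_eval)

lemma eval_scaleR: "eval (c *\<^sub>R g) F = c * eval g F"
  by (cases "F \<in> spectrum \<and> F \<noteq> {}")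
    (auto simp: eval_outside intro!: eval_eqI value_at_scaleR value_at_eval)

lemma eval_sup: "eval (sup g h) F = max (eval g F) (eval h F)"
  by (cases "F \<in> spectrum \<and> F \<noteq> {}")
    (auto simp: eval_outside intro!: eval_eqI value_at_sup value_at_eval)

lemma linear_eval: "linear (\<lambda>g. eval g F)"
  by (rule linearI) (auto simp: eval_add eval_scaleR)

lemma eval_inf: "eval (inf g h) F = min (eval g F) (eval h F)"
  unfolding inf_eq_add_diff_sup using linear_diff[OF linear_eval, of "g + h" "sup g h" F]
  by (simp add: eval_add eval_sup)

lemma eval_nonneg: "0 \<le> g \<Longrightarrow> 0 \<le> eval g F"
  using eval_sup[of g 0 F] linear_0[OF linear_eval, of F] by (simp add: sup_absorb1)

lemma eval_tr: "0 \<le> g \<Longrightarrow> eval (tr g) F = min (eval g F) 1"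
  by (cases "F \<in> spectrum \<and> F \<noteq> {}")
    (auto simp: eval_outside intro!: eval_eqI value_at_tr value_at_eval eval_nonneg)

lemma eval_unital:
  assumes "u \<in> unitals" "F \<in> spectrum"
  shows "eval u F = (if u \<in> F then 1 else 0)"
  using value_at_unital_mem[OF assms(2)] value_at_unital_not_mem[OF assms(2) _ assms(1)]
    eval_eqI[OF assms(2)] eval_outside[of F u]
  by (cases "F = {}") auto

text \<open>The elements \<open>h\<close> with \<open>perp g h\<close> form a linear subspace that
  contains all unital components. By simplicity it is everything, so \<open>g\<close> is disjoint
  from itself.\<close>

lemma disjoint_from_unitals_imp_0:
  assumes "0 \<le> g" "\<And>u. u \<in> unitals \<Longrightarrow> inf u g = 0"
  shows "g = 0"
proof -
  have "perp g h" if "h \<in> span unitals" for h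
    using that
  proof (induction rule: span_induct_alt)
    case (step c u h)
    show ?case by (rule perp_add[OF perp_scaleR[OF inf_eq_0_imp_perp[OF assms(2)[OF step(1)]]] step(2)])
  qed (simp add: perp_zero assms(1))
  then show ?thesis using simple perp_self by blast
qed

text \<open>The unital components disjoint from \<open>g\<close> form an ideal \<open>I\<close>. If
  it missed \<open>u\<close>, some filter \<open>F\<close> would contain \<open>u\<close> and avoid
  \<open>I\<close>; but value 0 at \<open>F\<close> says that a member of \<open>F\<close> is
  disjoint from \<open>g\<close>, hence in \<open>I\<close>.\<close>

lemma eval_eq_0_imp_nonneg:
  assumes "0 \<le> g" and 0: "\<And>F. eval g F = 0"
  shows "g = 0"
proof (rule disjoint_from_unitals_imp_0)
  fix u assume u: "u \<in> unitals"
  define I where "I = {v \<in> unitals. inf v g = 0}"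
  show "inf u g = 0"
  proof (rule ccontr)
    assume "inf u g \<noteq> 0"
    then have "u \<notin> I" unfolding I_def by blast
    moreover have "0 \<in> I" unfolding I_def using zero_unital assms(1) by (simp add: inf_absorb1)
    moreover have "I \<subseteq> unitals" unfolding I_def by blast
    moreover have "w \<in> I" if "v \<in> I" "w \<in> unitals" "w \<le> v" for v w
    proof -
      have "inf w g \<le> inf v g" using that(3) by (rule inf_mono) simp
      moreover have "inf v g = 0" using that(1) unfolding I_def by blast
      moreover have "0 \<le> inf w g" using unital_nonneg[OF that(2)] assms(1) by simp
      ultimately show ?thesis using that(2) unfolding I_def by simp
    qed
    moreover have "sup v w \<in> I" if "v \<in> I" "w \<in> I" for v w
      using that sup_unital inf_sup_distrib_left[of g v w] unfolding I_def
      by (simp add: inf_commute)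
    ultimately obtain F where F: "F \<in> spectrum" "u \<in> F" "F \<inter> I = {}"
      using spectrum_separation[OF u] by blast
    then have "value_at F g 0" using value_at_eval[of F g] 0 by force
    then obtain v where v: "v \<in> F" "perp v g" unfolding value_at_def by auto
    have "v \<in> I"
      using perp_imp_inf_eq_0[OF v(2) assms(1)] v(1) spectrumD(1)[OF F(1)]
      unfolding I_def by (auto simp: inf_commute)
    then show False using v F by blast
  qed
qed (use assms in auto)

lemma inj_eval: "inj eval"
proof (rule injI)
  fix g h assume eq: "eval g = eval h"
  have le: "a \<le> b" if "eval a = eval b" for a b
  proof -
    \<comment> \<open>This difference is nonnegative, and it vanishes exactly when \<open>a\<close>
      is below \<open>b\<close>.\<close>
    have "sup a b - b = 0"
    proof (rule eval_eq_0_imp_nonneg)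
      show "eval (sup a b - b) F = 0" for F
        using linear_diff[OF linear_eval, of "sup a b" b F] that by (simp add: eval_sup)
    qed simp
    then show ?thesis by (metis eq_iff_diff_eq_0 sup.cobounded1)
  qed
  show "g = h" using le eq by (auto intro: antisym)
qed

end

subsection \<open>Locally constant functions on compact spaces\<close>

text \<open>Compactness as an induction principle, in place of explicit finite subcovers: local
  validity and stability under binary unions give one open set around \<open>K\<close>.\<close>

lemma compactin_cover_induct:
  assumes K: "compactin X K" and empty: "P {}" and Un: "\<And>A B. P A \<Longrightarrow> P B \<Longrightarrow> P (A \<union> B)"
    and loc: "\<And>x. x \<in> K \<Longrightarrow> \<exists>V. openin X V \<and> x \<in> V \<and> P V"
  obtains V where "openin X V" "K \<subseteq> V" "P V"
proof -
  let ?\<U> = "{V. openin X V \<and> P V}"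
  have "K \<subseteq> \<Union>?\<U>" using loc by blast
  then obtain \<F> where \<F>: "finite \<F>" "\<F> \<subseteq> ?\<U>" "K \<subseteq> \<Union>\<F>"
    using compactinD[OF K, of ?\<U>] by blast
  have "P (\<Union>\<F>)"
    using \<F>(1,2) by (induction \<F> rule: finite_induct) (auto intro: empty Un)
  moreover have "openin X (\<Union>\<F>)" using \<F>(2) by blast
  ultimately show thesis using that \<F>(3) by blast
qed

text \<open>Clopen sets missing \<open>x\<close> cover the compact complement of \<open>W\<close>. A
  finite union of them still misses \<open>x\<close>, and its complement is a clopen neighborhood of
  \<open>x\<close> inside \<open>W\<close>.\<close>

lemma dim_le_0_if_clopen_separated:
  assumes X: "compact_space X"
    and sep: "\<And>x y. \<lbrakk>x \<in> topspace X; y \<in> topspace X; x \<noteq> y\<rbrakk> \<Longrightarrow>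
      \<exists>V. openin X V \<and> closedin X V \<and> y \<in> V \<and> x \<notin> V"
  shows "X dim_le 0"
  unfolding dimension_le_0_neighbourhood_base_of_clopen neighbourhood_base_of
proof (intro allI impI)
  fix W x assume W: "openin X W \<and> x \<in> W"
  then have x: "x \<in> topspace X" using openin_subset by blast
  define P where "P V \<longleftrightarrow> closedin X V \<and> x \<notin> V" for V
  have "compactin X (topspace X - W)" using W closedin_compact_space[OF X] by blast
  then obtain V where V: "openin X V" "topspace X - W \<subseteq> V" "P V"
  proof (rule compactin_cover_induct[where P=P])
    show "\<exists>V. openin X V \<and> y \<in> V \<and> P V" if "y \<in> topspace X - W" for y
      using sep[OF x, of y] that W unfolding P_def by blast
  qed (auto simp: P_def)
  then have "openin X (topspace X - V) \<and> closedin X (topspace X - V)" unfolding P_def by blast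
  moreover have "x \<in> topspace X - V" "topspace X - V \<subseteq> W" using V x unfolding P_def by blast+
  ultimately show "\<exists>U V. openin X U \<and> (closedin X V \<and> openin X V) \<and> x \<in> U \<and> U \<subseteq> V \<and> V \<subseteq> W"
    by blast
qed

lemma clopen_separated_if_dim_le_0:
  assumes "X dim_le 0" "Hausdorff_space X" "x \<in> topspace X" "y \<in> topspace X" "x \<noteq> y"
  obtains V where "openin X V" "closedin X V" "x \<in> V" "y \<notin> V"
proof -
  have "openin X (topspace X - {y})"
    using assms closedin_Hausdorff_sing_eq[of X y] by blast
  moreover have "x \<in> topspace X - {y}" using assms by blast
  ultimately obtain U V where "closedin X V" "openin X V" "x \<in> U" "U \<subseteq> V" "V \<subseteq> topspace X - {y}"
    using assms(1) unfolding dimension_le_0_neighbourhood_base_of_clopen neighbourhood_base_of by metis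
  then show thesis using that[of V] by blast
qed

lemma locally_constant_on_const: "locally_constant_on X (\<lambda>x. c)"
  unfolding locally_constant_on_def by blast

lemma locally_constant_on_combine:
  assumes "locally_constant_on X f" "locally_constant_on X g"
  shows "locally_constant_on X (\<lambda>x. h (f x) (g x))"
  unfolding locally_constant_on_def
proof
  fix x assume "x \<in> topspace X"
  then obtain U V where U: "openin X U" "x \<in> U" "\<forall>y\<in>U. f y = f x"
    and V: "openin X V" "x \<in> V" "\<forall>y\<in>V. g y = g x"
    using assms unfolding locally_constant_on_def by meson
  have "h (f y) (g y) = h (f x) (g x)" if "y \<in> U \<inter> V" for y
    using bspec[OF U(3), of y] bspec[OF V(3), of y] that by simp
  then show "\<exists>W. openin X W \<and> x \<in> W \<and> (\<forall>y\<in>W. h (f y) (g y) = h (f x) (g x))"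
    using U(1,2) V(1,2) by (intro exI[of _ "U \<inter> V"]) blast
qed

lemma openin_locally_constant_preimage:
  assumes "locally_constant_on X f"
  shows "openin X {x \<in> topspace X. f x \<in> S}"
proof (subst openin_subopen, intro ballI)
  fix x assume "x \<in> {x \<in> topspace X. f x \<in> S}"
  moreover from this obtain U where "openin X U" "x \<in> U" "\<forall>y\<in>U. f y = f x"
    using assms unfolding locally_constant_on_def by blast
  ultimately show "\<exists>T. openin X T \<and> x \<in> T \<and> T \<subseteq> {x \<in> topspace X. f x \<in> S}"
    using openin_subset by (intro exI[of _ U]) fastforce
qed

lemma closedin_locally_constant_preimage:
  assumes "locally_constant_on X f"
  shows "closedin X {x \<in> topspace X. f x \<in> S}"
proof -
  have "topspace X - {x \<in> topspace X. f x \<in> S} = {x \<in> topspace X. f x \<in> - S}" by blast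
  then show ?thesis
    unfolding closedin_def using openin_locally_constant_preimage[OF assms, of "- S"] by auto
qed

lemma locally_constant_on_indicator:
  assumes "openin X K" "closedin X K"
  shows "locally_constant_on X (\<lambda>x. if x \<in> K then a else b)"
  unfolding locally_constant_on_def
proof
  fix x assume "x \<in> topspace X"
  moreover have "openin X (topspace X - K)" using assms by blast
  ultimately show "\<exists>U. openin X U \<and> x \<in> U \<and> (\<forall>y\<in>U. (if y \<in> K then a else b) = (if x \<in> K then a else b))"
    using assms(1) by (cases "x \<in> K") (metis, metis Diff_iff)
qed

lemma finite_range_locally_constant:
  assumes "compact_space X" "locally_constant_on X f"
  shows "finite (f ` topspace X)"
proof -
  have "compactin X (topspace X)" using assms(1) unfolding compact_space_def .
  then obtain V where "topspace X \<subseteq> V" "finite (f ` V)"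
  proof (rule compactin_cover_induct[where P="\<lambda>V. finite (f ` V)"])
    fix x assume "x \<in> topspace X"
    then obtain V where V: "openin X V" "x \<in> V" "\<forall>y\<in>V. f y = f x"
      using assms(2) unfolding locally_constant_on_def by blast
    then have "f ` V \<subseteq> {f x}" by blast
    then show "\<exists>V. openin X V \<and> x \<in> V \<and> finite (f ` V)" using V(1,2) finite_subset[of "f ` V" "{f x}"] by blast
  qed (auto simp: image_Un)
  then show ?thesis using finite_subset[OF image_mono] by metis
qed

subsection \<open>The spectrum as a Boolean space\<close>

context trunc
begin

text \<open>The Stone topology, inherited from the cube of all subsets of \<open>G\<close> through
  characteristic functions; this form makes the Tychonoff theorem available.\<close>

definition spectral_topology :: "'g set topology"
  where "spectral_topology =
    pullback_topology spectrum (\<lambda>F u. u \<in> F) (product_topology (\<lambda>_. discrete_topology UNIV) UNIV)"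

lemma topspace_spectral [simp]: "topspace spectral_topology = spectrum"
  unfolding spectral_topology_def topspace_pullback_topology by auto

lemma openin_discrete_product_coordinate:
  "openin (product_topology (\<lambda>_. discrete_topology UNIV) UNIV) {f. f u = b}"
proof -
  let ?P = "product_topology (\<lambda>_. discrete_topology UNIV) UNIV"
  have "openin ?P {f \<in> topspace ?P. f u \<in> {b}}"
    by (rule openin_continuous_map_preimage[OF continuous_map_product_projection]) auto
  then show ?thesis by simp
qed

lemma openin_spectral_coordinate: "openin spectral_topology {F \<in> spectrum. (u \<in> F) = b}"
  unfolding spectral_topology_def openin_pullback_topology
  by (rule exI[of _ "{f. f u = b}"]) (auto simp: openin_discrete_product_coordinate)

lemma openin_spectral_basic: "openin spectral_topology {F \<in> spectrum. u \<in> F}"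
  using openin_spectral_coordinate[of u True] by simp

lemma openin_spectral_basic_compl: "openin spectral_topology {F \<in> spectrum. u \<notin> F}"
  using openin_spectral_coordinate[of u False] by simp

lemma closedin_spectral_basic: "closedin spectral_topology {F \<in> spectrum. u \<in> F}"
proof -
  have "spectrum - {F \<in> spectrum. u \<in> F} = {F \<in> spectrum. u \<notin> F}" by blast
  then show ?thesis unfolding closedin_def using openin_spectral_basic_compl by auto
qed

lemma closedin_spectral_basic_compl: "closedin spectral_topology {F \<in> spectrum. u \<notin> F}"
proof -
  have "spectrum - {F \<in> spectrum. u \<notin> F} = {F \<in> spectrum. u \<in> F}" by blast
  then show ?thesis unfolding closedin_def using openin_spectral_basic by auto
qed

text \<open>A violated condition of \<open>spectrum\<close> involves at most three memberships, with
  repetitions as padding. Hence the sets outside the spectrum form an open part of the cube.\<close>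

lemma spectrum_failure_finite:
  assumes "F \<notin> spectrum"
  obtains a b c where "\<And>G. \<lbrakk>(a \<in> G) = (a \<in> F); (b \<in> G) = (b \<in> F); (c \<in> G) = (c \<in> F)\<rbrakk> \<Longrightarrow> G \<notin> spectrum"
proof -
  consider u where "u \<in> F" "u \<notin> unitals" | "0 \<in> F"
    | u v where "u \<in> unitals" "v \<in> unitals" "(inf u v \<in> F) \<noteq> (u \<in> F \<and> v \<in> F)"
    | u v where "u \<in> unitals" "v \<in> unitals" "(sup u v \<in> F) \<noteq> (u \<in> F \<or> v \<in> F)"
    using assms unfolding spectrum_def by blast
  then show thesis
  proof cases
    case 1
    then show thesis using that[of u u u] spectrumD(1) by blast
  next
    case 2
    then show thesis using that[of 0 0 0] spectrumD(2) by blast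
  next
    case 3
    then show thesis using that[of "inf u v" u v] spectrumD(3) by blast
  next
    case 4
    then show thesis using that[of "sup u v" u v] spectrumD(4) by blast
  qed
qed

lemma compact_space_spectral: "compact_space spectral_topology"
proof -
  let ?P = "product_topology (\<lambda>_. discrete_topology UNIV) UNIV :: ('g \<Rightarrow> bool) topology"
  define S where "S = {f. Collect f \<in> spectrum}"
  have "openin ?P (- S)"
  proof (subst openin_subopen, intro ballI)
    fix f assume "f \<in> - S"
    then have "Collect f \<notin> spectrum" unfolding S_def by blast
    then obtain a b c where abc: "\<And>G. \<lbrakk>(a \<in> G) = f a; (b \<in> G) = f b; (c \<in> G) = f c\<rbrakk> \<Longrightarrow> G \<notin> spectrum"
      using spectrum_failure_finite[of "Collect f"] by (metis mem_Collect_eq)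
    let ?T = "{g. g a = f a} \<inter> {g. g b = f b} \<inter> {g. g c = f c}"
    have "openin ?P ?T" by (intro openin_Int openin_discrete_product_coordinate)
    moreover have "?T \<subseteq> - S" using abc unfolding S_def by force
    ultimately show "\<exists>T. openin ?P T \<and> f \<in> T \<and> T \<subseteq> - S" by blast
  qed
  then have "closedin ?P S" unfolding closedin_def by (simp add: Compl_eq_Diff_UNIV)
  moreover have "compact_space ?P"
    by (simp add: compact_space_product_topology compact_space_discrete_topology)
  ultimately have "compact_space (subtopology ?P S)"
    by (simp add: closedin_compact_space compact_space_subtopology)
  moreover have "continuous_map (subtopology ?P S) spectral_topology Collect"
    unfolding spectral_topology_def
    by (rule continuous_map_pullback') (auto simp: S_def comp_def)
  moreover have "Collect ` S = spectrum" unfolding S_def by (auto intro!: image_eqI[of _ Collect "\<lambda>u. u \<in> _"])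
  ultimately show ?thesis
    using image_compactin[of "subtopology ?P S" S spectral_topology Collect]
    unfolding compact_space_def by simp
qed

lemma spectral_clopen_separated:
  assumes "F \<in> spectrum" "G \<in> spectrum" "F \<noteq> G"
  shows "\<exists>V. openin spectral_topology V \<and> closedin spectral_topology V \<and> G \<in> V \<and> F \<notin> V"
proof -
  obtain u where "u \<in> G \<and> u \<notin> F \<or> u \<notin> G \<and> u \<in> F" using assms(3) by blast
  then show ?thesis
  proof
    assume "u \<in> G \<and> u \<notin> F"
    then show ?thesis
      using openin_spectral_basic closedin_spectral_basic assms
      by (intro exI[of _ "{F \<in> spectrum. u \<in> F}"]) auto
  next
    assume "u \<notin> G \<and> u \<in> F"
    then show ?thesis
      using openin_spectral_basic_compl closedin_spectral_basic_compl assms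
      by (intro exI[of _ "{F \<in> spectrum. u \<notin> F}"]) auto
  qed
qed

lemma Hausdorff_space_spectral: "Hausdorff_space spectral_topology"
  unfolding Hausdorff_space_def
proof (intro allI impI)
  fix F G assume FG: "F \<in> topspace spectral_topology \<and> G \<in> topspace spectral_topology \<and> F \<noteq> G"
  then obtain V where "openin spectral_topology V" "closedin spectral_topology V" "G \<in> V" "F \<notin> V"
    using spectral_clopen_separated by (metis topspace_spectral)
  then have "openin spectral_topology (spectrum - V) \<and> openin spectral_topology V \<and>
      F \<in> spectrum - V \<and> G \<in> V \<and> disjnt (spectrum - V) V"
    using FG openin_diff[OF openin_topspace, of spectral_topology V] by (auto simp: disjnt_def)
  then show "\<exists>U V. openin spectral_topology U \<and> openin spectral_topology V \<and> F \<in> U \<and> G \<in> V \<and> disjnt U V"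
    by blast
qed

lemma boolean_pointed_space_spectral: "boolean_pointed_space spectral_topology {}"
  unfolding boolean_pointed_space_def
  using compact_space_spectral Hausdorff_space_spectral empty_spectrum
    dim_le_0_if_clopen_separated[OF compact_space_spectral] spectral_clopen_separated
  by simp

text \<open>Near a nonempty filter, membership conditions suffice: with a fixed member
  \<open>w0\<close>, exclusion of \<open>u\<close> is enforced by membership of
  \<open>w0 - inf w0 u\<close>. By compactness finitely many conditions exclude the complement of
  \<open>W\<close>, and they merge by \<open>inf\<close>.\<close>

lemma spectral_basis:
  assumes F: "F \<in> spectrum" "F \<noteq> {}" and W: "openin spectral_topology W" "F \<in> W"
  obtains w where "w \<in> F" "{G \<in> spectrum. w \<in> G} \<subseteq> W"
proof -
  define P where "P V \<longleftrightarrow> (\<exists>w\<in>F. {G \<in> spectrum. w \<in> G} \<inter> V = {})" for V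
  obtain w0 where w0: "w0 \<in> F" using F by blast
  note U = spectrumD(1)[OF F(1)]
  have "compactin spectral_topology (spectrum - W)"
    using W(1) closedin_compact_space[OF compact_space_spectral, of "spectrum - W"]
    by (simp add: openin_closedin_eq)
  then obtain V where "spectrum - W \<subseteq> V" "P V"
  proof (rule compactin_cover_induct[where P=P])
    show "P {}" unfolding P_def using w0 by blast
  next
    fix A B assume "P A" "P B"
    then obtain v w where vw: "v \<in> F" "w \<in> F"
      "{G \<in> spectrum. v \<in> G} \<inter> A = {}" "{G \<in> spectrum. w \<in> G} \<inter> B = {}"
      unfolding P_def by blast
    have "v \<in> unitals" "w \<in> unitals" using vw U by blast+
    then have "inf v w \<in> F" "{G \<in> spectrum. inf v w \<in> G} \<inter> (A \<union> B) = {}"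
      using vw spectrumD(3) F(1) by blast+
    then show "P (A \<union> B)" unfolding P_def by blast
  next
    fix G assume G: "G \<in> spectrum - W"
    then have "F \<noteq> G" using W(2) by blast
    then consider u where "u \<in> F" "u \<notin> G" | u where "u \<in> G" "u \<notin> F" by blast
    then show "\<exists>V. openin spectral_topology V \<and> G \<in> V \<and> P V"
    proof cases
      case 1
      then show ?thesis
        using G openin_spectral_basic_compl unfolding P_def
        by (intro exI[of _ "{F \<in> spectrum. u \<notin> F}"]) auto
    next
      case 2
      have "u \<in> unitals" "w0 \<in> unitals" using 2 G w0 U spectrumD(1) by blast+
      then have "w0 - inf w0 u \<in> F" "{G \<in> spectrum. w0 - inf w0 u \<in> G} \<inter> {F \<in> spectrum. u \<in> F} = {}"
        using spectrum_diff_iff w0 2 F(1) by blast+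
      then show ?thesis
        using 2 G openin_spectral_basic unfolding P_def
        by (intro exI[of _ "{F \<in> spectrum. u \<in> F}"]) auto
    qed
  qed
  then show thesis using that unfolding P_def by blast
qed

text \<open>All points of \<open>K\<close> are nonempty filters, so basic sets inside
  \<open>K\<close> cover it. Finitely many suffice, and their union is the basic set of a
  supremum.\<close>

lemma spectral_clopen_eq_basic:
  assumes K: "openin spectral_topology K" "closedin spectral_topology K" "{} \<notin> K"
  obtains u where "u \<in> unitals" "K = {F \<in> spectrum. u \<in> F}"
proof -
  define P where "P V \<longleftrightarrow> (\<exists>u\<in>unitals. V = {F \<in> spectrum. u \<in> F} \<and> V \<subseteq> K)" for V
  have "K \<subseteq> spectrum" using openin_subset[OF K(1)] by simp
  have "compactin spectral_topology K" using closedin_compact_space[OF compact_space_spectral K(2)] .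
  then obtain V where "K \<subseteq> V" "P V"
  proof (rule compactin_cover_induct[where P=P])
    show "P {}" unfolding P_def using zero_unital spectrumD(2) by blast
  next
    fix A B assume "P A" "P B"
    then obtain u v where u: "u \<in> unitals" "A = {F \<in> spectrum. u \<in> F}" "A \<subseteq> K"
      and v: "v \<in> unitals" "B = {F \<in> spectrum. v \<in> F}" "B \<subseteq> K"
      unfolding P_def by blast
    then have "A \<union> B = {F \<in> spectrum. sup u v \<in> F}" using spectrumD(4) by blast
    then show "P (A \<union> B)" unfolding P_def using sup_unital u v by blast
  next
    fix F assume F: "F \<in> K"
    then obtain w where w: "w \<in> F" "{G \<in> spectrum. w \<in> G} \<subseteq> K"
      using spectral_basis[OF _ _ K(1)] K(3) \<open>K \<subseteq> spectrum\<close> by (metis subsetD)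
    then show "\<exists>V. openin spectral_topology V \<and> F \<in> V \<and> P V"
      using F \<open>K \<subseteq> spectrum\<close> openin_spectral_basic spectrumD(1) unfolding P_def
      by (intro exI[of _ "{G \<in> spectrum. w \<in> G}"]) blast
  qed
  then show thesis using that unfolding P_def by blast
qed

end

section \<open>The image of the embedding\<close>

context simple_trunc
begin

lemma locally_constant_eval: "locally_constant_on spectral_topology (eval g)"
proof -
  have "g \<in> span unitals" by (rule simple)
  then show ?thesis
  proof (induction rule: span_induct_alt)
    case base
    have "eval 0 = (\<lambda>F. 0)" using linear_0[OF linear_eval] by blast
    then show ?case by (simp add: locally_constant_on_const)
  next
    case (step c u g)
    have "locally_constant_on spectral_topology (eval u)"
      unfolding locally_constant_on_def
    proof
      fix F assume F: "F \<in> topspace spectral_topology"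
      then show "\<exists>U. openin spectral_topology U \<and> F \<in> U \<and> (\<forall>G\<in>U. eval u G = eval u F)"
        using openin_spectral_coordinate[of u "u \<in> F"] step(1)
        by (intro exI[of _ "{G \<in> spectrum. (u \<in> G) = (u \<in> F)}"]) (simp add: eval_unital)
    qed
    from locally_constant_on_combine[OF this step(2), of "\<lambda>a b. c * a + b"]
    have "locally_constant_on spectral_topology (\<lambda>F. c * eval u F + eval g F)" .
    moreover have "(\<lambda>F. c * eval u F + eval g F) = eval (c *\<^sub>R u + g)"
      by (rule ext) (simp only: eval_add eval_scaleR)
    ultimately show ?case by metis
  qed
qed

text \<open>The level set of a nonzero \<open>c\<close> is clopen and avoids the empty filter, so a
  unital component \<open>u c\<close> describes it. Only finitely many values occur, and
  \<open>f\<close> is the corresponding combination.\<close>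

lemma eval_surj:
  assumes f: "f \<in> loc_const_functions spectral_topology {}"
  obtains g where "eval g = f"
proof -
  have lc: "locally_constant_on spectral_topology f" and f0: "f {} = 0" "\<And>F. F \<notin> spectrum \<Longrightarrow> f F = 0"
    using f unfolding loc_const_functions_def by auto
  have "\<exists>u. u \<in> unitals \<and> {F \<in> spectrum. f F = c} = {F \<in> spectrum. u \<in> F}" if "c \<noteq> 0" for c
  proof -
    have "openin spectral_topology {F \<in> spectrum. f F = c}" "closedin spectral_topology {F \<in> spectrum. f F = c}"
      using openin_locally_constant_preimage[OF lc, of "{c}"] closedin_locally_constant_preimage[OF lc, of "{c}"]
      by simp_all
    moreover have "{} \<notin> {F \<in> spectrum. f F = c}" using f0(1) that by simp
    ultimately show ?thesis by (rule spectral_clopen_eq_basic) blast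
  qed
  then have "\<forall>c. \<exists>u. c \<noteq> 0 \<longrightarrow> u \<in> unitals \<and> {F \<in> spectrum. f F = c} = {F \<in> spectrum. u \<in> F}"
    by blast
  from choice[OF this] obtain u where u: "\<And>c. c \<noteq> 0 \<Longrightarrow> u c \<in> unitals"
      "\<And>c. c \<noteq> 0 \<Longrightarrow> {F \<in> spectrum. f F = c} = {F \<in> spectrum. u c \<in> F}"
    by blast
  define C where "C = f ` spectrum - {0}"
  have "finite C" unfolding C_def
    using finite_range_locally_constant[OF compact_space_spectral lc] by simp
  define g where "g = (\<Sum>c\<in>C. c *\<^sub>R u c)"
  have "eval g F = f F" for F
  proof (cases "F \<in> spectrum")
    case True
    have "eval g F = (\<Sum>c\<in>C. c * eval (u c) F)"
      unfolding g_def using linear_sum[OF linear_eval, of "\<lambda>c. c *\<^sub>R u c" C F] by (simp add: eval_scaleR)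
    also have "\<dots> = (\<Sum>c\<in>C. if c = f F then c else 0)"
    proof (rule sum.cong[OF refl])
      fix c assume "c \<in> C"
      then have "c \<noteq> 0" unfolding C_def by blast
      then have "u c \<in> F \<longleftrightarrow> f F = c" using u(2) True by blast
      then show "c * eval (u c) F = (if c = f F then c else 0)"
        using eval_unital[OF u(1)[OF \<open>c \<noteq> 0\<close>] True] by auto
    qed
    \<comment> \<open>If \<open>f F\<close> is 0, no index in \<open>C\<close> matches, and the sum
      is 0 as well.\<close>
    also have "\<dots> = f F" using \<open>finite C\<close> True by (auto simp: C_def)
    finally show ?thesis .
  qed (simp add: eval_outside f0)
  then show thesis using that by blast
qed

lemma represents_spectral: "represents spectral_topology {} tr"
proof -
  have "eval g \<in> loc_const_functions spectral_topology {}" for g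
    unfolding loc_const_functions_def using locally_constant_eval by (simp add: eval_outside)
  then have "bij_betw eval UNIV (loc_const_functions spectral_topology {})"
    using inj_eval eval_surj unfolding bij_betw_def by (metis (no_types, lifting) image_subset_iff rangeI subsetI subset_antisym)
  then have "trunc_iso_loc_const tr spectral_topology {} eval"
    unfolding trunc_iso_loc_const_def
    by (auto simp: eval_add eval_scaleR eval_inf eval_sup eval_tr)
  then show ?thesis
    unfolding represents_def using boolean_pointed_space_spectral by blast
qed

end

subsection \<open>Uniqueness\<close>

locale trunc_representation = simple_trunc tr for tr :: "'g::vector_lattice \<Rightarrow> 'g" +
  fixes X :: "'x topology" and p :: 'x and \<phi> :: "'g \<Rightarrow> 'x \<Rightarrow> real"
  assumes space: "boolean_pointed_space X p" and iso: "trunc_iso_loc_const tr X p \<phi>"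
begin

lemma X_compact: "compact_space X" and X_Hausdorff: "Hausdorff_space X"
  and X_dim: "X dim_le 0" and p_in: "p \<in> topspace X"
  using space unfolding boolean_pointed_space_def by blast+

lemma rep_add: "\<phi> (g + h) x = \<phi> g x + \<phi> h x"
  and rep_scaleR: "\<phi> (c *\<^sub>R g) x = c * \<phi> g x"
  and rep_inf: "\<phi> (inf g h) x = min (\<phi> g x) (\<phi> h x)"
  and rep_sup: "\<phi> (sup g h) x = max (\<phi> g x) (\<phi> h x)"
  and rep_tr: "0 \<le> g \<Longrightarrow> \<phi> (tr g) x = min (\<phi> g x) 1"
  and rep_bij: "bij_betw \<phi> UNIV (loc_const_functions X p)"
  using iso unfolding trunc_iso_loc_const_def by simp_all

lemma rep_zero: "\<phi> 0 x = 0"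
  using rep_scaleR[of 0 0 x] by simp

lemma rep_diff: "\<phi> (g - h) x = \<phi> g x - \<phi> h x"
  using rep_add[of "g - h" h x] by simp

lemma rep_eqI: "(\<And>x. \<phi> g x = \<phi> h x) \<Longrightarrow> g = h"
  using rep_bij unfolding bij_betw_def by (meson ext injD)

lemma rep_le_iff: "g \<le> h \<longleftrightarrow> (\<forall>x. \<phi> g x \<le> \<phi> h x)"
proof -
  have "g \<le> h \<longleftrightarrow> inf g h = g" by (simp add: inf_absorb1 le_iff_inf)
  also have "\<dots> \<longleftrightarrow> (\<forall>x. \<phi> (inf g h) x = \<phi> g x)" using rep_eqI by metis
  also have "\<dots> \<longleftrightarrow> (\<forall>x. \<phi> g x \<le> \<phi> h x)" by (simp add: rep_inf min_def)
  finally show ?thesis .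
qed

lemma rep_in: "\<phi> g \<in> loc_const_functions X p"
  using rep_bij unfolding bij_betw_def by blast

lemma rep_locally_constant: "locally_constant_on X (\<phi> g)" and rep_at_p: "\<phi> g p = 0"
  and rep_outside: "x \<notin> topspace X \<Longrightarrow> \<phi> g x = 0"
  using rep_in[of g] unfolding loc_const_functions_def by blast+

text \<open>Truncating \<open>2 *\<^sub>R u\<close> gives back \<open>u\<close>, so a value
  \<open>t\<close> satisfies \<open>min (2 * t) 1 = t\<close>, which leaves only 0 and 1.\<close>

lemma rep_unital_cases:
  assumes "u \<in> unitals"
  shows "\<phi> u x = 0 \<or> \<phi> u x = 1"
proof -
  have "0 \<le> 2 *\<^sub>R u" using unital_nonneg[OF assms] by (simp add: scaleR_nonneg_nonneg)
  then have "min (2 * \<phi> u x) 1 = \<phi> u x"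
    using rep_tr[of "2 *\<^sub>R u" x] tr_scaleR_unital[OF assms, of 2] by (simp add: rep_scaleR)
  then show ?thesis by linarith
qed

text \<open>A truncated \<open>g\<close> has values between 0 and 1, so meeting it with
  \<open>u\<close> either keeps or kills its value at each point. Being a component can be checked
  pointwise.\<close>

lemma unital_if_rep_cases:
  assumes u: "\<And>x. \<phi> u x = 0 \<or> \<phi> u x = 1"
  shows "u \<in> unitals"
proof -
  have "0 \<le> u" unfolding rep_le_iff rep_zero using u by (metis order_refl zero_le_one)
  moreover have "tr u = u"
  proof (rule rep_eqI)
    show "\<phi> (tr u) x = \<phi> u x" for x using rep_tr[OF \<open>0 \<le> u\<close>, of x] u[of x] by auto
  qed
  moreover have "component_of (inf u g) g" if "g \<in> truncated tr" for g
  proof -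
    have g: "0 \<le> g" "tr g = g" using that by (auto simp: truncated_iff)
    have *: "0 \<le> \<phi> g x" "\<phi> g x \<le> 1" for x
      using g(1) rep_tr[OF g(1), of x] g(2) unfolding rep_le_iff rep_zero by auto
    have "inf (inf u g) (g - inf u g) = 0"
    proof (rule rep_eqI)
      show "\<phi> (inf (inf u g) (g - inf u g)) x = \<phi> 0 x" for x
        using u[of x] *[of x] by (auto simp: rep_inf rep_diff rep_zero)
    qed
    then show ?thesis unfolding component_of_def using g \<open>0 \<le> u\<close> by simp
  qed
  ultimately show ?thesis unfolding unital_component_def by (simp add: truncated_iff)
qed

lemma clopen_unital:
  assumes K: "openin X K" "closedin X K" "p \<notin> K"
  obtains u where "u \<in> unitals" "\<And>x. \<phi> u x = (if x \<in> K then 1 else 0)"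
proof -
  have "(\<lambda>x. if x \<in> K then 1 else 0) \<in> loc_const_functions X p"
    unfolding loc_const_functions_def
    using locally_constant_on_indicator[OF K(1,2)] openin_subset[OF K(1)] K(3) by auto
  then obtain u where "\<phi> u = (\<lambda>x. if x \<in> K then 1 else 0)"
    using rep_bij unfolding bij_betw_def by (metis imageE)
  then have u: "\<And>x. \<phi> u x = (if x \<in> K then 1 else 0)" by simp
  show thesis by (rule that[OF unital_if_rep_cases u]) (simp add: u)
qed

definition point :: "'x \<Rightarrow> 'g set"
  where "point x = {u \<in> unitals. \<phi> u x = 1}"

lemma point_iff: "u \<in> point x \<longleftrightarrow> u \<in> unitals \<and> \<phi> u x = 1"
  unfolding point_def by simp

lemma point_spectrum: "point x \<in> spectrum"
  unfolding spectrum_def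
proof (intro CollectI conjI ballI)
  fix u v assume "u \<in> unitals" "v \<in> unitals"
  then show "inf u v \<in> point x \<longleftrightarrow> u \<in> point x \<and> v \<in> point x"
    and "sup u v \<in> point x \<longleftrightarrow> u \<in> point x \<or> v \<in> point x"
    using inf_unital[of u v] sup_unital[of u v] rep_unital_cases[of u x] rep_unital_cases[of v x]
    unfolding point_iff rep_inf rep_sup by auto
qed (auto simp: point_def rep_zero)

lemma point_p: "point p = {}"
  unfolding point_def by (simp add: rep_at_p)

text \<open>Only clopen sets avoiding \<open>p\<close> come from unital components, so
  \<open>V\<close>, which separates \<open>x\<close> from \<open>y\<close>, is cut down by
  \<open>W\<close>, which removes \<open>p\<close>. This requires \<open>x\<close> to differ from
  \<open>p\<close>; of two distinct points at least one does, hence the use of \<open>sep\<close> in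
  both orders.\<close>

lemma inj_point: "inj_on point (topspace X)"
proof -
  have sep: "point x \<noteq> point y"
    if xy: "x \<in> topspace X" "y \<in> topspace X" "x \<noteq> y" "x \<noteq> p" for x y
  proof -
    obtain V where V: "openin X V" "closedin X V" "x \<in> V" "y \<notin> V"
      using clopen_separated_if_dim_le_0[OF X_dim X_Hausdorff xy(1,2,3)] .
    obtain W where W: "openin X W" "closedin X W" "x \<in> W" "p \<notin> W"
      using clopen_separated_if_dim_le_0[OF X_dim X_Hausdorff xy(1) p_in xy(4)] .
    obtain u where "u \<in> unitals" "\<And>z. \<phi> u z = (if z \<in> V \<inter> W then 1 else 0)"
      using clopen_unital[of "V \<inter> W"] V W by auto
    then have "u \<in> point x" "u \<notin> point y" using V W unfolding point_iff by auto
    then show ?thesis by blast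
  qed
  show ?thesis
  proof (rule inj_onI)
    fix x y assume "x \<in> topspace X" "y \<in> topspace X" "point x = point y"
    then show "x = y" using sep[of x y] sep[of y x] by metis
  qed
qed

lemma continuous_point: "continuous_map X spectral_topology point"
  unfolding spectral_topology_def
proof (rule continuous_map_pullback')
  show "continuous_map X (product_topology (\<lambda>_. discrete_topology UNIV) UNIV) ((\<lambda>F u. u \<in> F) \<circ> point)"
    unfolding continuous_map_componentwise_UNIV
  proof
    fix u
    have "openin X {x \<in> topspace X. (u \<in> point x) \<in> S}" for S
    proof -
      \<comment> \<open>For fixed \<open>u\<close>, membership in \<open>point x\<close> depends
        only on the locally constant value \<open>\<phi> u x\<close>.\<close>
      have "{x \<in> topspace X. (u \<in> point x) \<in> S} =
        {x \<in> topspace X. \<phi> u x \<in> {c. (u \<in> unitals \<and> c = 1) \<in> S}}"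
        unfolding point_iff by simp
      then show ?thesis by (simp only: openin_locally_constant_preimage[OF rep_locally_constant])
    qed
    then show "continuous_map X (discrete_topology UNIV) (\<lambda>x. ((\<lambda>F u. u \<in> F) \<circ> point) x u)"
      unfolding continuous_map_def by simp
  qed
qed (use point_spectrum in auto)

lemma point_surj:
  assumes F: "F \<in> spectrum"
  shows "F \<in> point ` topspace X"
proof (cases "F = {}")
  case True
  then show ?thesis using point_p p_in by blast
next
  case False
  \<comment> \<open>Otherwise near every point some member of \<open>F\<close> vanishes. By
    compactness and closure under \<open>inf\<close>, one member vanishes everywhere, but 0 belongs
    to no filter.\<close>
  have "\<exists>x\<in>topspace X. \<forall>u\<in>F. \<phi> u x = 1"
  proof (rule ccontr)
    assume no: "\<not> ?thesis"
    define P where "P V \<longleftrightarrow> (\<exists>w\<in>F. \<forall>x\<in>V. \<phi> w x = 0)" for V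
    have "compactin X (topspace X)" using X_compact unfolding compact_space_def .
    then obtain V where V: "topspace X \<subseteq> V" "P V"
    proof (rule compactin_cover_induct[where P=P])
      show "P {}" unfolding P_def using False by blast
    next
      fix A B assume "P A" "P B"
      then obtain v w where vw: "v \<in> F" "w \<in> F" "\<forall>x\<in>A. \<phi> v x = 0" "\<forall>x\<in>B. \<phi> w x = 0"
        unfolding P_def by blast
      then have U: "v \<in> unitals" "w \<in> unitals" using spectrumD(1)[OF F] by blast+
      then have "inf v w \<in> F" using spectrumD(3)[OF F] vw by blast
      moreover have "\<phi> (inf v w) x = 0" if "x \<in> A \<union> B" for x
        using that vw(3,4) rep_unital_cases[OF U(1), of x] rep_unital_cases[OF U(2), of x]
        by (auto simp: rep_inf)
      ultimately show "P (A \<union> B)" unfolding P_def by blast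
    next
      fix x assume x: "x \<in> topspace X"
      then obtain u where u: "u \<in> F" "\<phi> u x \<noteq> 1" using no by blast
      then have "u \<in> unitals" using spectrumD(1)[OF F] by blast
      then have "\<phi> u x = 0" using rep_unital_cases u by blast
      then show "\<exists>V. openin X V \<and> x \<in> V \<and> P V"
        using openin_locally_constant_preimage[OF rep_locally_constant, of u "{0}"] x u(1)
        unfolding P_def by (intro exI[of _ "{x \<in> topspace X. \<phi> u x \<in> {0}}"]) auto
    qed
    then obtain w where w: "w \<in> F" "\<forall>x\<in>V. \<phi> w x = 0" unfolding P_def by blast
    have "w = 0"
    proof (rule rep_eqI)
      show "\<phi> w x = \<phi> 0 x" for x
        using w(2) V(1) rep_outside[of x w] by (cases "x \<in> topspace X") (auto simp: rep_zero)
    qed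
    then show False using w(1) spectrumD(2)[OF F] by blast
  qed
  then obtain x where x: "x \<in> topspace X" "\<And>u. u \<in> F \<Longrightarrow> \<phi> u x = 1" by blast
  obtain w where w: "w \<in> F" "w \<in> unitals" using False spectrumD(1)[OF F] by blast
  \<comment> \<open>For the reverse inclusion: if \<open>v\<close> were missing, the part of
    \<open>w\<close> outside \<open>v\<close> would be in \<open>F\<close> and have value 1 at
    \<open>x\<close>, although both \<open>w\<close> and \<open>v\<close> have value 1
    there.\<close>
  have "v \<in> F" if v: "v \<in> unitals" "\<phi> v x = 1" for v
  proof (rule ccontr)
    assume "v \<notin> F"
    then have "w - inf w v \<in> F" using spectrum_diff_iff[OF F w(2) v(1)] w(1) by blast
    then have "\<phi> (w - inf w v) x = 1" by (rule x(2))
    then show False using x(2)[OF w(1)] v(2) by (simp add: rep_diff rep_inf)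
  qed
  then have "F = point x" using x(2) spectrumD(1)[OF F] unfolding point_def by blast
  then show ?thesis using x(1) by blast
qed

lemma homeomorphic_point: "homeomorphic_map X spectral_topology point"
proof (rule continuous_imp_homeomorphic_map[OF continuous_point X_compact Hausdorff_space_spectral])
  show "point ` topspace X = topspace spectral_topology"
    using point_surj point_spectrum by auto
qed (rule inj_point)

end

section \<open>Comparison of two representing spaces through the spectrum\<close>

lemma represents_homeomorphic_spectral:
  assumes "simple_trunc tr" "represents X p tr"
  shows "pointed_homeomorphic X p (trunc.spectral_topology tr) {}"
proof -
  obtain \<phi> where "boolean_pointed_space X p" "trunc_iso_loc_const tr X p \<phi>"
    using assms(2) unfolding represents_def by blast
  then interpret trunc_representation tr X p \<phi>
    using assms(1) by (simp add: trunc_representation_def trunc_representation_axioms_def)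
  show ?thesis
    unfolding pointed_homeomorphic_def using homeomorphic_point point_p by blast
qed

lemma pointed_homeomorphic_sym_trans:
  assumes "pointed_homeomorphic X p Z r" "pointed_homeomorphic Y q Z r" "q \<in> topspace Y"
  shows "pointed_homeomorphic X p Y q"
proof -
  obtain f g where f: "homeomorphic_map X Z f" "f p = r" and g: "homeomorphic_map Y Z g" "g q = r"
    using assms unfolding pointed_homeomorphic_def by blast
  obtain k where "homeomorphic_maps Y Z g k" using g homeomorphic_map_maps by blast
  \<comment> \<open>The inverse undoes \<open>g\<close> only on the space itself, so
    \<open>q\<close> must be known to lie in \<open>Y\<close>.\<close>
  then have k: "homeomorphic_map Z Y k" "\<And>y. y \<in> topspace Y \<Longrightarrow> k (g y) = y"
    by (auto simp: homeomorphic_maps_map)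
  have "homeomorphic_map X Y (k \<circ> f)" using f k homeomorphic_map_compose by blast
  moreover have "(k \<circ> f) p = q" using f g k(2)[OF assms(3)] by simp
  ultimately show ?thesis unfolding pointed_homeomorphic_def by blast
qed

theorem theorem8p1p1:
  fixes tr :: "'g::vector_lattice \<Rightarrow> 'g"
  assumes "simple_trunc tr"
  shows "(\<exists>(X :: 'g set topology) p. represents X p tr) \<and>
    (\<forall>(X :: 'x topology) p (Y :: 'y topology) q.
       represents X p tr \<and> represents Y q tr \<longrightarrow> pointed_homeomorphic X p Y q)"
proof (intro conjI allI impI)
  show "\<exists>(X :: 'g set topology) p. represents X p tr"
    using simple_trunc.represents_spectral[OF assms] by blast
next
  fix X :: "'x topology" and p and Y :: "'y topology" and q
  assume *: "represents X p tr \<and> represents Y q tr"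
  then have "q \<in> topspace Y" unfolding represents_def boolean_pointed_space_def by blast
  then show "pointed_homeomorphic X p Y q"
    using pointed_homeomorphic_sym_trans represents_homeomorphic_spectral[OF assms] * by metis
qed

end
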